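(* Let $K=[-1,1]\cup[0,i]\subset\mathbb{C}$ be the $T$-shape set and let $g$ be an element of $C(K)$ outside the closed unit ball $\overline{B_{C(K)}}$. Then $g$ can be separated from $\overline{B_{C(K)}}$ by an $H$-invariant continuous polynomial $P$ if and only if $$\max\{|g(0)|,|g(1)|,|g(-1)|,|g(i)|\}>1.$$
   Context: $[0,i]$ denotes the closed segment in $\mathbb{C}$ from $0$ to $i$. $C(K)$ is the Banach space of complex-valued continuous functions on $K$ with the supremum norm. $H$ is the group of composition operators $\gamma:C(K)\to C(K)$ of the form $\gamma(f)=f\circ\phi$ for some homeomorphism $\phi:K\to K$. A (complex-valued) polynomial $P$ on $C(K)$ is $H$-invariant if $P\circ\gamma=P$ for every $\gamma\in H$. A polynomial $P$ separates a point $g$ and a set $B$ if $\sup_{f\in B}|P(f)|<|P(g)|$. *)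

theory Defs
  imports "HOL-Analysis.Analysis"
begin

section \<open>The T-shape set as a topological space\<close>

definition tshape_set :: "complex set" where
  "tshape_set = closed_segment (-1) 1 \<union> closed_segment 0 \<i>"

lemma tshape_set_mem [simp]:
  "0 \<in> tshape_set" "1 \<in> tshape_set" "-1 \<in> tshape_set" "\<i> \<in> tshape_set"
  by (auto simp: tshape_set_def)

typedef tshape = tshape_set
  by (rule exI[of _ 0]) simp

instantiation tshape :: metric_space
begin

definition dist_tshape :: "tshape \<Rightarrow> tshape \<Rightarrow> real" where
  "dist_tshape x y = dist (Rep_tshape x) (Rep_tshape y)"

definition uniformity_tshape :: "(tshape \<times> tshape) filter" where
  "uniformity_tshape = (INF e\<in>{0 <..}. principal {(x, y). dist x y < e})"

definition open_tshape :: "tshape set \<Rightarrow> bool" where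
  "open_tshape U = (\<forall>x\<in>U. \<forall>\<^sub>F (x', y) in uniformity. x' = x \<longrightarrow> y \<in> U)"

instance
proof
  fix x y z :: tshape
  show "dist x y = 0 \<longleftrightarrow> x = y"
    by (simp add: dist_tshape_def Rep_tshape_inject)
  show "dist x y \<le> dist x z + dist y z"
    unfolding dist_tshape_def by (rule dist_triangle2)
qed (simp_all add: uniformity_tshape_def open_tshape_def)

end

lemma homeomorphism_tshape: "homeomorphism UNIV tshape_set Rep_tshape Abs_tshape"
proof (rule homeomorphismI)
  show "continuous_on UNIV Rep_tshape"
    by (force simp: continuous_on_iff dist_tshape_def)
  show "continuous_on tshape_set Abs_tshape"
    by (force simp: continuous_on_iff dist_tshape_def Abs_tshape_inverse)
qed (auto simp: Rep_tshape Rep_tshape_inverse Abs_tshape_inverse)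

text \<open>Every continuous function on the T-shape is bounded, so \<open>tshape \<Rightarrow>\<^sub>C complex\<close> is the
  whole space of complex-valued continuous functions, with the supremum norm.\<close>

lemma compact_tshape: "compact (UNIV :: tshape set)"
proof -
  have "compact tshape_set"
    by (simp add: tshape_set_def compact_Un)
  moreover have "tshape_set homeomorphic (UNIV :: tshape set)"
    using homeomorphism_tshape homeomorphic_def homeomorphic_sym by blast
  ultimately show ?thesis
    using homeomorphic_compactness by blast
qed

lemma continuous_on_tshape_bcontfun:
  fixes f :: "tshape \<Rightarrow> complex"
  assumes "continuous_on UNIV f"
  shows "f \<in> bcontfun"
  using assms compact_continuous_image[OF assms compact_tshape] compact_imp_bounded
  by (auto simp: bcontfun_def)


section \<open>Complex polynomials on spaces of continuous functions\<close>

text \<open>The library makes \<open>'a \<Rightarrow>\<^sub>C complex\<close> a real vector space only.\<close>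

definition cscale :: "complex \<Rightarrow> ('a::topological_space \<Rightarrow>\<^sub>C complex) \<Rightarrow> ('a \<Rightarrow>\<^sub>C complex)" where
  "cscale c f = Bcontfun (\<lambda>x. c * apply_bcontfun f x)"

lemma apply_cscale [simp]: "apply_bcontfun (cscale c f) x = c * apply_bcontfun f x"
proof -
  have "bounded ((*) c ` range (apply_bcontfun f))"
    by (rule bounded_linear_image) (auto intro: bounded_linear_mult_right)
  then have "(\<lambda>x. c * apply_bcontfun f x) \<in> bcontfun"
    by (auto simp: bcontfun_def image_image intro!: continuous_intros)
  then show ?thesis
    by (simp add: cscale_def Bcontfun_inverse)
qed

lemma vector_space_cscale:
  "vector_space (cscale :: complex \<Rightarrow> ('a::topological_space \<Rightarrow>\<^sub>C complex) \<Rightarrow> _)"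
  by unfold_locales (auto intro!: bcontfun_eqI simp: algebra_simps)

text \<open>A \<open>k\<close>-tuple of vectors is encoded as a sequence of which only the entries with index below
  \<open>k\<close> matter. Since \<open>A\<close> depends on these entries only, continuity for the product topology on
  sequences is continuity for the product topology on \<open>k\<close>-tuples.\<close>

definition continuous_multilinear ::
    "nat \<Rightarrow> ((nat \<Rightarrow> ('a::topological_space \<Rightarrow>\<^sub>C complex)) \<Rightarrow> complex) \<Rightarrow> bool" where
  "continuous_multilinear k A \<longleftrightarrow>
     (\<forall>u v. (\<forall>i<k. u i = v i) \<longrightarrow> A u = A v) \<and>
     (\<forall>i<k. \<forall>u. Vector_Spaces.linear cscale (*) (\<lambda>f. A (u(i := f)))) \<and>
     continuous_on UNIV A"

definition continuous_homogeneous_polynomial ::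
    "nat \<Rightarrow> (('a::topological_space \<Rightarrow>\<^sub>C complex) \<Rightarrow> complex) \<Rightarrow> bool" where
  "continuous_homogeneous_polynomial k P \<longleftrightarrow>
     (\<exists>A. continuous_multilinear k A \<and> (\<forall>f. P f = A (\<lambda>_. f)))"

definition continuous_polynomial ::
    "(('a::topological_space \<Rightarrow>\<^sub>C complex) \<Rightarrow> complex) \<Rightarrow> bool" where
  "continuous_polynomial P \<longleftrightarrow>
     (\<exists>n Q. (\<forall>k\<le>n. continuous_homogeneous_polynomial k (Q k)) \<and> (\<forall>f. P f = (\<Sum>k\<le>n. Q k f)))"


section \<open>Composition operators, invariance and separation\<close>

definition composition_group ::
    "(('a::topological_space \<Rightarrow>\<^sub>C complex) \<Rightarrow> ('a \<Rightarrow>\<^sub>C complex)) set" where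
  "composition_group =
     {\<gamma>. \<exists>\<phi> \<psi>. homeomorphism UNIV UNIV \<phi> \<psi> \<and>
        (\<forall>f. apply_bcontfun (\<gamma> f) = apply_bcontfun f \<circ> \<phi>)}"

definition invariant_under :: "('b \<Rightarrow> 'b) set \<Rightarrow> ('b \<Rightarrow> complex) \<Rightarrow> bool" where
  "invariant_under G P \<longleftrightarrow> (\<forall>\<gamma>\<in>G. P \<circ> \<gamma> = P)"

text \<open>The supremum is taken in the extended reals, so that it is \<open>\<infinity>\<close> when \<open>P\<close> is unbounded
  on \<open>B\<close>.\<close>

definition separates :: "('b \<Rightarrow> complex) \<Rightarrow> 'b \<Rightarrow> 'b set \<Rightarrow> bool" where
  "separates P g B \<longleftrightarrow> (SUP f\<in>B. ereal (cmod (P f))) < ereal (cmod (P g))"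

end

theory Submission
  imports Defs
begin

text \<open>An evaluation power sum over a finite set of points that every homeomorphism permutes is
  invariant, and by simultaneous Dirichlet approximation some exponent makes it large as soon as
  one of the values has modulus greater than \<open>1\<close>. The branch point and the set of the three end
  points are such sets.

  Conversely, an invariant polynomial sees a function only through its values at these four points.
  If \<open>h\<close> is supported in an arc of an edge on which \<open>u\<close> is constant, then \<open>h\<close> can be squeezed into
  \<open>N\<close> disjoint subarcs without changing \<open>P (u + h)\<close>. Averaging \<open>|P|\<^sup>2\<close> over roots of unity
  coefficients of the \<open>N\<close> copies gives a sum bounded by a constant and at least
  \<open>c N |P (u + h) - P u|\<^sup>2\<close> with \<open>c > 0\<close>, so \<open>P (u + h) = P u\<close>. Hence, viewing a function on an
  edge as a path in the complex plane, loops may be inserted and deleted, and any two paths with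
  the same end points are interchangeable; line segments stay in the unit disc.\<close>


section \<open>Polynomials and roots of unity\<close>

text \<open>A geometric sum whose ratio \<open>?w\<close> is an \<open>n\<close>-th root of unity,
  different from 1 because \<open>n\<close> does not divide \<open>m\<close>.\<close>

lemma sum_power_roots_of_unity:
  fixes n m :: nat
  assumes "0 < m" "m < n"
  shows "(\<Sum>j<n. (cis (2 * pi / n) ^ j) ^ m) = 0"
proof -
  let ?w = "cis (2 * pi * m / n)"
  have w: "(cis (2 * pi / n) ^ j) ^ m = ?w ^ j" for j
  proof -
    have "(cis (2 * pi / n) ^ j) ^ m = (cis (2 * pi / n) ^ m) ^ j"
      by (simp flip: power_mult add: mult.commute)
    then show ?thesis by (simp add: Complex.DeMoivre mult_ac)
  qed
  have "?w = exp (2 * of_real pi * \<i> * of_nat m / of_nat n)"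
    by (simp add: cis_conv_exp mult_ac)
  moreover have "\<not> n dvd m"
    using assms by (simp add: nat_dvd_not_less)
  ultimately have "?w \<noteq> 1" "?w ^ n = 1"
    using assms complex_root_unity_eq_1[of n m] complex_root_unity[of n m] by auto
  then show ?thesis unfolding w by (simp add: sum_gp_strict)
qed

text \<open>A discrete mean value property at 0. It is exact because every exponent from 1 up to the
  degree lies below \<open>n\<close>, so the corresponding powers of the roots sum to zero.\<close>

lemma poly_mean_roots_of_unity:
  fixes p :: "complex poly"
  assumes "degree p < n"
  shows "(\<Sum>j<n. poly p (cis (2 * pi / n) ^ j)) = of_nat n * poly p 0"
proof -
  let ?w = "cis (2 * pi / n)"
  have "(\<Sum>j<n. poly p (?w ^ j)) = (\<Sum>j<n. \<Sum>i\<le>degree p. coeff p i * (?w ^ j) ^ i)"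
    by (simp add: poly_altdef)
  also have "\<dots> = (\<Sum>i\<le>degree p. coeff p i * (\<Sum>j<n. (?w ^ j) ^ i))"
    unfolding sum_distrib_left by (rule sum.swap)
  also have "\<dots> = (\<Sum>i\<in>{0}. coeff p i * (\<Sum>j<n. (?w ^ j) ^ i))"
    using assms by (intro sum.mono_neutral_right) (auto intro!: sum_power_roots_of_unity)
  finally show ?thesis by (simp add: poly_0_coeff_0)
qed

text \<open>Induction on the number \<open>l\<close> of slots filled with
  \<open>u + cscale z h\<close>. Linearity in slot \<open>l\<close> leaves \<open>u\<close> or
  \<open>h\<close> there, and either is absorbed into \<open>w\<close>, hence
  \<open>arbitrary: w\<close>; the \<open>h\<close> term carries the extra factor
  \<open>z\<close>.\<close>

lemma continuous_multilinear_poly: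
  assumes A: "continuous_multilinear k A" and "l \<le> k"
  shows "\<exists>p. degree p \<le> l \<and> (\<forall>z. A (\<lambda>i. if i < l then u + cscale z h else w i) = poly p z)"
  using \<open>l \<le> k\<close>
proof (induction l arbitrary: w)
  case 0
  show ?case by (rule exI[of _ "[:A w:]"]) simp
next
  case (Suc l)
  obtain p where p: "degree p \<le> l"
      "\<And>z. A (\<lambda>i. if i < l then u + cscale z h else (w(l := u)) i) = poly p z"
    using Suc.IH[of "w(l := u)"] Suc.prems by auto
  obtain q where q: "degree q \<le> l"
      "\<And>z. A (\<lambda>i. if i < l then u + cscale z h else (w(l := h)) i) = poly q z"
    using Suc.IH[of "w(l := h)"] Suc.prems by auto
  have "A (\<lambda>i. if i < Suc l then u + cscale z h else w i) = poly (p + pCons 0 q) z" for z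
  proof -
    define W where "W = (\<lambda>i. if i < l then u + cscale z h else w i)"
    have lin: "Vector_Spaces.linear cscale (*) (\<lambda>f. A (W(l := f)))"
      using A Suc.prems by (auto simp: continuous_multilinear_def)
    have upd: "(\<lambda>i. if i < l then u + cscale z h else (w(l := f)) i) = W(l := f)" for f
      by (auto simp: W_def)
    have "(\<lambda>i. if i < Suc l then u + cscale z h else w i) = W(l := u + cscale z h)"
      by (auto simp: W_def less_Suc_eq)
    then have "A (\<lambda>i. if i < Suc l then u + cscale z h else w i) = A (W(l := u + cscale z h))"
      by simp
    also have "\<dots> = A (W(l := u)) + z * A (W(l := h))"
      using lin unfolding Vector_Spaces.linear_iff by (simp only:)
    also have "\<dots> = poly (p + pCons 0 q) z"
      using p(2)[of z] q(2)[of z] by (simp add: upd)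
    finally show ?thesis .
  qed
  moreover have "degree (p + pCons 0 q) \<le> Suc l"
    using p(1) q(1) by (intro degree_add_le) (auto simp: degree_pCons_eq_if)
  ultimately show ?case by blast
qed

text \<open>The degree bound \<open>n\<close> is uniform in \<open>u\<close> and \<open>h\<close>,
  so that one order of roots of unity serves all complex lines at once.\<close>

lemma continuous_polynomial_line:
  assumes "continuous_polynomial P"
  obtains n where "\<And>u h. \<exists>p. degree p \<le> n \<and> (\<forall>z. P (u + cscale z h) = poly p z)"
proof -
  from assms obtain n Q where hom: "\<And>k. k \<le> n \<Longrightarrow> continuous_homogeneous_polynomial k (Q k)"
    and P: "\<And>f. P f = (\<Sum>k\<le>n. Q k f)"
    unfolding continuous_polynomial_def by blast
  have "\<exists>p. degree p \<le> n \<and> (\<forall>z. P (u + cscale z h) = poly p z)" for u h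
  proof -
    have "\<exists>p. degree p \<le> k \<and> (\<forall>z. Q k (u + cscale z h) = poly p z)" if k: "k \<le> n" for k
    proof -
      obtain A where A: "continuous_multilinear k A" "\<And>f. Q k f = A (\<lambda>_. f)"
        using hom[OF k] unfolding continuous_homogeneous_polynomial_def by blast
      have "A (\<lambda>_. f) = A (\<lambda>i. if i < k then f else 0)" for f
        using A(1) by (auto simp: continuous_multilinear_def)
      with continuous_multilinear_poly[OF A(1) order_refl, of u h "\<lambda>_. 0"] A(2)
      show ?thesis by simp
    qed
    then obtain p where p: "\<And>k. k \<le> n \<Longrightarrow> degree (p k) \<le> k"
        "\<And>k z. k \<le> n \<Longrightarrow> Q k (u + cscale z h) = poly (p k) z"
      by metis
    have "P (u + cscale z h) = poly (\<Sum>k\<le>n. p k) z" for z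
      by (simp add: P poly_sum p(2))
    moreover have "degree (\<Sum>k\<le>n. p k) \<le> n"
      by (rule degree_sum_le) (use p(1) in \<open>auto intro: order_trans\<close>)
    ultimately show ?thesis by blast
  qed
  with that show thesis by blast
qed

lemma continuous_polynomial_continuous:
  assumes "continuous_polynomial P"
  shows "continuous_on UNIV P"
proof -
  from assms obtain n Q where hom: "\<And>k. k \<le> n \<Longrightarrow> continuous_homogeneous_polynomial k (Q k)"
    and P: "P = (\<lambda>f. \<Sum>k\<le>n. Q k f)"
    unfolding continuous_polynomial_def by blast
  have "continuous_on UNIV (Q k)" if k: "k \<le> n" for k
  proof -
    obtain A where A: "continuous_multilinear k A" "Q k = (\<lambda>f. A (\<lambda>_. f))"
      using hom[OF k] unfolding continuous_homogeneous_polynomial_def by blast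
    have "continuous_on UNIV A"
      using A(1) by (simp add: continuous_multilinear_def)
    then show ?thesis
      unfolding A(2) by (rule continuous_on_compose2)
        (auto intro!: continuous_on_coordinatewise_then_product)
  qed
  then show ?thesis
    unfolding P by (intro continuous_intros) auto
qed

text \<open>The mean square is the squared modulus of the mean \<open>c\<close> plus the variance;
  of the variance only the term at \<open>k\<close> is kept.\<close>

lemma mean_norm_square_ge:
  fixes z :: "nat \<Rightarrow> complex"
  assumes "0 < n" and mean: "(\<Sum>j<n. z j) = of_nat n * c" and "k < n"
  shows "(\<Sum>j<n. (cmod (z j))\<^sup>2) \<ge> n * (cmod c)\<^sup>2 + (cmod (z k - c))\<^sup>2"
proof -
  have "(cmod (z j))\<^sup>2 = (cmod c)\<^sup>2 + (cmod (z j - c))\<^sup>2 + 2 * Re (cnj c * (z j - c))" for j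
    unfolding cmod_power2 by (simp add: algebra_simps power2_eq_square)
  then have "(\<Sum>j<n. (cmod (z j))\<^sup>2)
      = (\<Sum>j<n. (cmod c)\<^sup>2 + (cmod (z j - c))\<^sup>2 + 2 * Re (cnj c * (z j - c)))"
    by (simp only:)
  also have "\<dots> = n * (cmod c)\<^sup>2 + (\<Sum>j<n. (cmod (z j - c))\<^sup>2)
      + 2 * Re (cnj c * (\<Sum>j<n. z j - c))"
    by (simp add: sum.distrib sum_distrib_left)
  also have "(\<Sum>j<n. z j - c) = 0"
    using mean by (simp add: sum_subtractf)
  finally have "(\<Sum>j<n. (cmod (z j))\<^sup>2) = n * (cmod c)\<^sup>2 + (\<Sum>j<n. (cmod (z j - c))\<^sup>2)"
    by simp
  moreover have "(\<Sum>j<n. (cmod (z j - c))\<^sup>2) \<ge> (cmod (z k - c))\<^sup>2"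
    using \<open>k < n\<close> by (intro member_le_sum) auto
  ultimately show ?thesis by linarith
qed

text \<open>Choosing the \<open>\<omega>\<close>s one at a time: the roots of unity average of the right-hand side at
  \<open>u + \<omega> h\<close> dominates its value at \<open>u\<close>, by the mean value property and convexity.\<close>

lemma roots_of_unity_increment:
  fixes P :: "('a::topological_space \<Rightarrow>\<^sub>C complex) \<Rightarrow> complex" and N :: nat
  assumes "0 < n"
    and mean: "\<And>u h. (\<Sum>j<n. P (u + cscale (cis (2 * pi / n) ^ j) h)) = of_nat n * P u"
  shows "\<exists>\<omega>. (\<forall>i. cmod (\<omega> i) = 1) \<and>
    n * (cmod (P (u + (\<Sum>i<N. cscale (\<omega> i) (h i)))))\<^sup>2
      \<ge> n * (cmod (P u))\<^sup>2 + (\<Sum>i<N. (cmod (P (u + h i) - P u))\<^sup>2)"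
proof (induction N arbitrary: u)
  case 0
  show ?case by (rule exI[of _ "\<lambda>_. 1"]) simp
next
  case (Suc N)
  let ?w = "\<lambda>j. cis (2 * pi / n) ^ j"
  let ?u = "\<lambda>j. u + cscale (?w j) (h N)"
  let ?R = "\<lambda>v. n * (cmod (P v))\<^sup>2 + (\<Sum>i<N. (cmod (P (v + h i) - P v))\<^sup>2)"
  \<comment> \<open>The difference of \<open>P\<close> at \<open>v + h i\<close> and at
    \<open>v\<close> inherits the mean value property in \<open>v\<close>.\<close>
  have jensen: "(\<Sum>j<n. (cmod (P (?u j + h i) - P (?u j)))\<^sup>2) \<ge> n * (cmod (P (u + h i) - P u))\<^sup>2" for i
  proof -
    have "(\<Sum>j<n. P (?u j + h i) - P (?u j)) = of_nat n * (P (u + h i) - P u)"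
      using mean[of "u + h i" "h N"] mean[of u "h N"]
      by (simp add: sum_subtractf algebra_simps)
    from mean_norm_square_ge[OF \<open>0 < n\<close> this \<open>0 < n\<close>] show ?thesis
      by (smt (verit) zero_le_power2)
  qed
  \<comment> \<open>Index 0 is the root 1, where the deviation from the mean is exactly the
    increment along \<open>h N\<close>.\<close>
  have "(\<Sum>j<n. (cmod (P (?u j)))\<^sup>2) \<ge> n * (cmod (P u))\<^sup>2 + (cmod (P (u + h N) - P u))\<^sup>2"
    using mean_norm_square_ge[OF \<open>0 < n\<close> mean \<open>0 < n\<close>, of u "h N"]
    by (simp add: cscale_def apply_bcontfun_inverse)
  then have "(\<Sum>j<n. ?R (?u j)) \<ge> n * (n * (cmod (P u))\<^sup>2 + (cmod (P (u + h N) - P u))\<^sup>2)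
      + (\<Sum>i<N. n * (cmod (P (u + h i) - P u))\<^sup>2)"
    unfolding sum.distrib sum_distrib_left[symmetric]
    apply (subst sum.swap)
    using sum_mono[of "{..<N}" "\<lambda>i. n * (cmod (P (u + h i) - P u))\<^sup>2", OF jensen]
    by (intro add_mono mult_left_mono) (auto simp: sum_distrib_left)
  also have "n * (n * (cmod (P u))\<^sup>2 + (cmod (P (u + h N) - P u))\<^sup>2)
      + (\<Sum>i<N. n * (cmod (P (u + h i) - P u))\<^sup>2)
      = (\<Sum>j<n. n * (cmod (P u))\<^sup>2 + (\<Sum>i<Suc N. (cmod (P (u + h i) - P u))\<^sup>2))"
    by (simp add: sum_distrib_left algebra_simps)
  \<comment> \<open>Some root of unity does at least as well as the average.\<close>
  finally have "\<exists>j. ?R (?u j) \<ge> n * (cmod (P u))\<^sup>2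
      + (\<Sum>i<Suc N. (cmod (P (u + h i) - P u))\<^sup>2)" (is "\<exists>j. _ \<ge> ?c")
  proof -
    assume le: "(\<Sum>j<n. ?c) \<le> (\<Sum>j<n. ?R (?u j))"
    show ?thesis
    proof (rule ccontr)
      assume "\<not> ?thesis"
      then have "(\<Sum>j<n. ?R (?u j)) < (\<Sum>j<n. ?c)"
        using \<open>0 < n\<close> by (intro sum_strict_mono) (auto simp: not_le)
      with le show False by linarith
    qed
  qed
  then obtain j where j: "?R (?u j) \<ge> ?c"
    by blast
  obtain \<omega> where \<omega>: "\<And>i. cmod (\<omega> i) = 1"
      "?R (?u j) \<le> n * (cmod (P (?u j + (\<Sum>i<N. cscale (\<omega> i) (h i)))))\<^sup>2"
    using Suc.IH[of "?u j"] by blast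
  define \<omega>' where "\<omega>' = (\<lambda>i. if i = N then ?w j else \<omega> i)"
  have eq: "?u j + (\<Sum>i<N. cscale (\<omega> i) (h i)) = u + (\<Sum>i<Suc N. cscale (\<omega>' i) (h i))"
    by (simp add: algebra_simps \<omega>'_def)
  have "cmod (\<omega>' i) = 1" for i
    by (simp add: \<omega>(1) \<omega>'_def norm_power)
  then show ?case
    using order_trans[OF j \<omega>(2)] unfolding eq by blast
qed

text \<open>The \<open>k i\<close> act as disjointly supported copies of \<open>h\<close>. Their
  sums with unimodular coefficients are no larger in norm than \<open>h\<close>, while the squared
  increments of \<open>P\<close> add up over the \<open>N\<close> copies. For small multiples of
  \<open>h\<close> this forces the increment to be 0; being polynomial in the scalar, it is then 0
  for \<open>h\<close> itself.\<close>

lemma continuous_polynomial_disjoint_copies: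
  fixes P :: "('a::topological_space \<Rightarrow>\<^sub>C complex) \<Rightarrow> complex"
  assumes P: "continuous_polynomial P"
    and copies: "\<And>N::nat. \<exists>k. (\<forall>i<N. \<forall>c. P (u + cscale c (k i)) = P (u + cscale c h)) \<and>
      (\<forall>i<N. norm (k i) \<le> norm h) \<and>
      (\<forall>x. \<forall>i<N. \<forall>j<N. k i x \<noteq> 0 \<longrightarrow> k j x \<noteq> 0 \<longrightarrow> i = j)"
  shows "P (u + h) = P u"
proof -
  obtain m where m: "\<And>u h. \<exists>p. degree p \<le> m \<and> (\<forall>z. P (u + cscale z h) = poly p z)"
    using continuous_polynomial_line[OF P] by blast
  define n where "n = Suc m"
  have mean: "(\<Sum>j<n. P (u + cscale (cis (2 * pi / n) ^ j) h)) = of_nat n * P u" for u h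
  proof -
    obtain p where p: "degree p \<le> m" "\<And>z. P (u + cscale z h) = poly p z"
      using m by blast
    have "cscale 0 h = 0" by (rule bcontfun_eqI) simp
    with p(2)[of 0] have "P u = poly p 0" by simp
    with p poly_mean_roots_of_unity[of p n] show ?thesis
      by (simp add: n_def del: sum.lessThan_Suc)
  qed
  \<comment> \<open>Continuity at \<open>u\<close> bounds \<open>P\<close> only near
    \<open>u\<close>, so multiples of \<open>h\<close> of small norm are treated first.\<close>
  obtain \<delta> where \<delta>: "\<delta> > 0" "\<And>f. dist f u < \<delta> \<Longrightarrow> dist (P f) (P u) < 1"
    using continuous_polynomial_continuous[OF P] unfolding continuous_on_iff
    by (metis UNIV_I zero_less_one)
  define M where "M = cmod (P u) + 1"
  have M: "cmod (P (u + f)) \<le> M" if "norm f < \<delta>" for f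
  proof -
    have "dist (P (u + f)) (P u) < 1" using that by (intro \<delta>) (simp add: dist_norm)
    then show ?thesis unfolding M_def dist_norm by norm
  qed
  have small: "P (u + cscale c h) = P u" if c: "cmod c * norm h < \<delta>" for c
  proof (rule ccontr)
    define d where "d = (cmod (P (u + cscale c h) - P u))\<^sup>2"
    assume "P (u + cscale c h) \<noteq> P u"
    then have "d > 0" by (simp add: d_def)
    \<comment> \<open>The \<open>N\<close> copies contribute \<open>N * d\<close> altogether, to be
      played off against the upper bound \<open>n * M\<^sup>2\<close>.\<close>
    then obtain N :: nat where N: "n * M\<^sup>2 < N * d"
      using reals_Archimedean3 by blast
    obtain k where k: "\<And>i c. i < N \<Longrightarrow> P (u + cscale c (k i)) = P (u + cscale c h)"
        "\<And>i. i < N \<Longrightarrow> norm (k i) \<le> norm h"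
        "\<And>x i j. i < N \<Longrightarrow> j < N \<Longrightarrow> k i x \<noteq> 0 \<Longrightarrow> k j x \<noteq> 0 \<Longrightarrow> i = j"
      using copies[of N] by blast
    obtain \<omega> where \<omega>: "\<And>i. cmod (\<omega> i) = 1"
        "n * (cmod (P (u + (\<Sum>i<N. cscale (\<omega> i) (cscale c (k i))))))\<^sup>2
          \<ge> n * (cmod (P u))\<^sup>2 + (\<Sum>i<N. (cmod (P (u + cscale c (k i)) - P u))\<^sup>2)"
      using roots_of_unity_increment[where P = P and n = n and N = N and u = u
          and h = "\<lambda>i. cscale c (k i)"] mean
      by (auto simp: n_def)
    let ?f = "\<Sum>i<N. cscale (\<omega> i) (cscale c (k i))"
    have apply_sum: "apply_bcontfun (\<Sum>i<J. F i) x = (\<Sum>i<J. F i x)"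
      for F :: "nat \<Rightarrow> 'a \<Rightarrow>\<^sub>C complex" and J x
      by (induction J) auto
    have "norm ?f \<le> cmod c * norm h"
    proof (rule norm_bound)
      fix x
      show "norm (?f x) \<le> cmod c * norm h"
      proof (cases "\<exists>i<N. k i x \<noteq> 0")
        case True
        then obtain i where i: "i < N" "k i x \<noteq> 0" by blast
        have "?f x = (\<Sum>j\<in>{i}. \<omega> j * (c * k j x))"
          unfolding apply_sum apply_cscale using i k(3)
          by (intro sum.mono_neutral_right) auto
        then have "norm (?f x) = cmod c * cmod (k i x)"
          by (simp add: norm_mult \<omega>(1))
        also have "\<dots> \<le> cmod c * norm h"
          using norm_bounded[of "k i" x] k(2)[OF i(1)] by (intro mult_left_mono) auto
        finally show ?thesis .
      next
        case False
        then show ?thesis by (simp add: apply_sum)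
      qed
    qed
    then have "cmod (P (u + ?f)) \<le> M" using c by (intro M) simp
    then have "n * (cmod (P (u + ?f)))\<^sup>2 \<le> n * M\<^sup>2"
      by (intro mult_left_mono power_mono) auto
    moreover have "(\<Sum>i<N. (cmod (P (u + cscale c (k i)) - P u))\<^sup>2) = N * d"
      by (simp add: k(1) d_def)
    ultimately have "n * (cmod (P u))\<^sup>2 + N * d \<le> n * M\<^sup>2"
      using \<omega>(2) by linarith
    moreover have "n * (cmod (P u))\<^sup>2 \<ge> 0" by simp
    ultimately show False using N by linarith
  qed
  obtain p where p: "\<And>z. P (u + cscale z h) = poly p z"
    using m by blast
  \<comment> \<open>On the ball of radius \<open>r\<close> the polynomial \<open>p\<close> takes the
    single value \<open>P u\<close>, so it is constant and may be evaluated at 1. Adding 1 to the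
    norm covers \<open>h = 0\<close>.\<close>
  define r where "r = \<delta> / (norm h + 1)"
  have "r > 0" using \<delta>(1) by (simp add: r_def add_nonneg_pos)
  have "poly (p - [:P u:]) z = 0" if "z \<in> ball 0 r" for z
  proof -
    have "cmod z * norm h \<le> cmod z * (norm h + 1)" by (simp add: algebra_simps)
    also have "\<dots> < \<delta>" using that
      by (simp add: r_def pos_less_divide_eq add_nonneg_pos)
    finally show ?thesis using small[of z] p by simp
  qed
  then have "ball 0 r \<subseteq> {z. poly (p - [:P u:]) z = 0}" by blast
  moreover have "infinite (ball (0::complex) r)"
    using \<open>r > 0\<close> uncountable_ball countable_finite by blast
  ultimately have "p - [:P u:] = 0"
    using poly_roots_finite finite_subset by blast
  then have "poly p 1 = P u" by simp
  moreover have "cscale 1 h = h" by (rule bcontfun_eqI) simp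
  ultimately show ?thesis using p[of 1] by simp
qed


section \<open>The three edges\<close>

definition tips :: "complex set" where
  "tips = {1, -1, \<i>}"

text \<open>The T-shape is viewed as a star of three unit segments from 0. The scalar product with
  \<open>v\<close> measures the distance from 0 along the edge of \<open>v\<close>; it is 0 on
  perpendicular edges and nonpositive on an opposite one, where \<open>max 0\<close> cuts it off.
  Thus the coordinate is positive exactly on the edge of \<open>v\<close> without the branch
  point.\<close>

definition edge_coord :: "complex \<Rightarrow> tshape \<Rightarrow> real" where
  "edge_coord v x = max 0 (Re (Rep_tshape x * cnj v))"

definition edge_pt :: "complex \<Rightarrow> real \<Rightarrow> tshape" where
  "edge_pt v t = Abs_tshape (of_real t * v)"

lemma tips_norm: "v \<in> tips \<Longrightarrow> cmod v = 1"
  by (auto simp: tips_def)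

lemma mem_tshape_set_iff:
  "z \<in> tshape_set \<longleftrightarrow> (\<exists>v\<in>tips. \<exists>t\<in>{0..1}. z = of_real t * v)"
proof
  assume "z \<in> tshape_set"
  then consider "z \<in> closed_segment (-1) 1" | "z \<in> closed_segment 0 \<i>"
    by (auto simp: tshape_set_def)
  then show "\<exists>v\<in>tips. \<exists>t\<in>{0..1}. z = of_real t * v"
  proof cases
    case 1
    then obtain s where s: "0 \<le> s" "s \<le> 1" "z = of_real (2 * s - 1)"
      unfolding closed_segment_def by (auto simp: scaleR_conv_of_real algebra_simps)
    show ?thesis
    proof (cases "2 * s - 1 \<ge> 0")
      case True
      then show ?thesis using s by (intro bexI[of _ 1] bexI[of _ "2 * s - 1"]) (auto simp: tips_def)
    next
      case False
      then show ?thesis using s by (intro bexI[of _ "-1"] bexI[of _ "1 - 2 * s"]) (auto simp: tips_def)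
    qed
  next
    case 2
    then show ?thesis
      unfolding closed_segment_def tips_def by (auto simp: scaleR_conv_of_real)
  qed
next
  assume "\<exists>v\<in>tips. \<exists>t\<in>{0..1}. z = of_real t * v"
  then obtain v t where vt: "v \<in> tips" "t \<in> {0..1}" "z = of_real t * v" by blast
  have "of_real t \<in> closed_segment (-1) (1::complex)"
    unfolding closed_segment_def using vt(2)
    by (intro CollectI exI[of _ "(1 + t) / 2"]) (auto simp: scaleR_conv_of_real field_simps)
  moreover have "- of_real t \<in> closed_segment (-1) (1::complex)"
    unfolding closed_segment_def using vt(2)
    by (intro CollectI exI[of _ "(1 - t) / 2"]) (auto simp: scaleR_conv_of_real field_simps)
  moreover have "of_real t * \<i> \<in> closed_segment 0 \<i>"
    unfolding closed_segment_def using vt(2) by (auto simp: scaleR_conv_of_real)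
  ultimately show "z \<in> tshape_set"
    using vt by (auto simp: tips_def tshape_set_def)
qed

lemma Rep_edge_pt: "v \<in> tips \<Longrightarrow> t \<in> {0..1} \<Longrightarrow> Rep_tshape (edge_pt v t) = of_real t * v"
  unfolding edge_pt_def by (rule Abs_tshape_inverse) (unfold mem_tshape_set_iff, blast)

lemma edge_coord_edge_pt:
  assumes "v \<in> tips" "w \<in> tips" "t \<in> {0..1}"
  shows "edge_coord v (edge_pt w t) = (if v = w then t else 0)"
  using assms by (auto simp: edge_coord_def Rep_edge_pt tips_def complex_eq_iff)

lemma edge_pt_0: "edge_pt v 0 = Abs_tshape 0"
  by (simp add: edge_pt_def)

lemma tshape_cases:
  obtains v t where "v \<in> tips" "t \<in> {0..1}" "x = edge_pt v t"
  using Rep_tshape[of x] Rep_tshape_inverse[of x] unfolding mem_tshape_set_iff edge_pt_def by metis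

lemma edge_coord_bounds: "v \<in> tips \<Longrightarrow> edge_coord v x \<in> {0..1}"
  by (cases x rule: tshape_cases) (auto simp: edge_coord_edge_pt)

lemma edge_pt_edge_coord:
  assumes "v \<in> tips" "edge_coord v x > 0"
  shows "edge_pt v (edge_coord v x) = x"
  using assms by (cases x rule: tshape_cases) (auto simp: edge_coord_edge_pt split: if_splits)

lemma continuous_on_Rep_tshape: "continuous_on S Rep_tshape"
  using homeomorphism_tshape continuous_on_subset unfolding homeomorphism_def by blast

lemma continuous_on_edge_coord: "continuous_on S (edge_coord v)"
  unfolding edge_coord_def by (intro continuous_intros continuous_on_Rep_tshape)

lemma dist_edge_pt:
  assumes "v \<in> tips" "s \<in> {0..1}" "t \<in> {0..1}"
  shows "dist (edge_pt v s) (edge_pt v t) = \<bar>s - t\<bar>"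
proof -
  have "dist (edge_pt v s) (edge_pt v t) = cmod (of_real (s - t) * v)"
    using assms by (simp add: dist_tshape_def Rep_edge_pt dist_norm algebra_simps)
  then show ?thesis using tips_norm[OF assms(1)] by (simp add: norm_mult del: of_real_diff)
qed

lemma continuous_on_edge_pt: "v \<in> tips \<Longrightarrow> continuous_on {0..1} (edge_pt v)"
  unfolding continuous_on_iff by (metis dist_edge_pt dist_real_def)


section \<open>Reparametrizations of an edge\<close>

text \<open>Coordinate 0 means the branch point or another edge, and there nothing moves; this fits
  together at the branch point when \<open>\<theta> 0 = 0\<close>.\<close>

definition edge_reparam :: "complex \<Rightarrow> (real \<Rightarrow> real) \<Rightarrow> tshape \<Rightarrow> tshape" where
  "edge_reparam v \<theta> x = (if edge_coord v x > 0 then edge_pt v (\<theta> (edge_coord v x)) else x)"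

text \<open>Monotonicity is meant weakly: the maps used later may rest on intervals, as in squeezing
  a bump or waiting at an end of a path.\<close>

locale edge_map =
  fixes v :: complex and \<theta> :: "real \<Rightarrow> real"
  assumes tip: "v \<in> tips"
    and cont: "continuous_on {0..1} \<theta>"
    and mono: "mono_on {0..1} \<theta>"
    and ends: "\<theta> 0 = 0" "\<theta> 1 = 1"
begin

lemma range: "t \<in> {0..1} \<Longrightarrow> \<theta> t \<in> {0..1}"
  using mono_onD[OF mono, of 0 t] mono_onD[OF mono, of t 1] ends by auto

lemma edge_coord_reparam: "edge_coord v (edge_reparam v \<theta> x) = \<theta> (edge_coord v x)"
  using tip edge_coord_bounds[OF tip, of x] range[of "edge_coord v x"] ends
  by (auto simp: edge_reparam_def edge_coord_edge_pt order_antisym_conv)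

lemma edge_reparam_pt: "t \<in> {0..1} \<Longrightarrow> edge_reparam v \<theta> (edge_pt v t) = edge_pt v (\<theta> t)"
  using ends by (auto simp: edge_reparam_def edge_coord_edge_pt tip less_le)

text \<open>A formula without case distinction: a point is displaced along \<open>v\<close> by the
  change of its coordinate. Continuity is read off from it.\<close>

lemma Rep_edge_reparam:
  "Rep_tshape (edge_reparam v \<theta> x) =
    Rep_tshape x + of_real (\<theta> (edge_coord v x) - edge_coord v x) * v"
proof (cases "edge_coord v x > 0")
  case True
  have "Rep_tshape x = of_real (edge_coord v x) * v"
    using Rep_edge_pt[OF tip edge_coord_bounds[OF tip]] edge_pt_edge_coord[OF tip True] by metis
  with True show ?thesis
    by (simp add: edge_reparam_def Rep_edge_pt[OF tip range[OF edge_coord_bounds[OF tip]]] algebra_simps)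
next
  case False
  then have "edge_coord v x = 0" using edge_coord_bounds[OF tip, of x] by auto
  then show ?thesis by (simp add: edge_reparam_def ends)
qed

lemma continuous_on_reparam: "continuous_on UNIV (edge_reparam v \<theta>)"
proof -
  have "continuous_on UNIV (\<lambda>x. Rep_tshape x + of_real (\<theta> (edge_coord v x) - edge_coord v x) * v)"
    using edge_coord_bounds[OF tip]
    by (intro continuous_intros continuous_on_Rep_tshape continuous_on_edge_coord
        continuous_on_compose2[OF cont]) auto
  then have "continuous_on UNIV (\<lambda>x. Rep_tshape (edge_reparam v \<theta> x))"
    by (simp add: Rep_edge_reparam)
  then show ?thesis
    unfolding continuous_on_iff dist_tshape_def .
qed

text \<open>By compactness a continuous bijection suffices; surjectivity comes from the intermediate
  value theorem.\<close>

lemma homeomorphism_reparam: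
  assumes inj: "inj_on \<theta> {0..1}"
  shows "\<exists>\<psi>. homeomorphism UNIV UNIV (edge_reparam v \<theta>) \<psi>"
proof (rule homeomorphism_compact[OF compact_tshape continuous_on_reparam])
  show "inj_on (edge_reparam v \<theta>) UNIV"
  proof (rule inj_onI)
    fix x y
    assume eq: "edge_reparam v \<theta> x = edge_reparam v \<theta> y"
    then have "\<theta> (edge_coord v x) = \<theta> (edge_coord v y)"
      by (metis edge_coord_reparam)
    then have coord: "edge_coord v x = edge_coord v y"
      using inj edge_coord_bounds[OF tip] by (metis inj_onD)
    show "x = y"
    proof (cases "edge_coord v x > 0")
      case True
      then show ?thesis using coord edge_pt_edge_coord[OF tip] by metis
    next
      case False
      then show ?thesis using coord eq by (simp add: edge_reparam_def)
    qed
  qed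
  have "y \<in> range (edge_reparam v \<theta>)" for y
  proof (cases "edge_coord v y > 0")
    case True
    obtain t where t: "t \<in> {0..1}" "\<theta> t = edge_coord v y"
      using IVT'[of \<theta> 0 "edge_coord v y" 1] cont ends edge_coord_bounds[OF tip, of y] by auto
    then have "edge_reparam v \<theta> (edge_pt v t) = y"
      using edge_pt_edge_coord[OF tip True] by (simp add: edge_reparam_pt)
    then show ?thesis by blast
  next
    case False
    then have "edge_reparam v \<theta> y = y" by (simp add: edge_reparam_def)
    then show ?thesis by (metis rangeI)
  qed
  then show "range (edge_reparam v \<theta>) = UNIV" by blast
qed

end

section \<open>Invariance under reparametrizations, and bumps on arcs of constancy\<close>

lemma apply_Bcontfun_tshape:
  "continuous_on UNIV f \<Longrightarrow> apply_bcontfun (Bcontfun f) x = f x" for f :: "tshape \<Rightarrow> complex"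
  by (simp add: Bcontfun_inverse continuous_on_tshape_bcontfun)

lemma invariant_homeomorphism:
  fixes P :: "(tshape \<Rightarrow>\<^sub>C complex) \<Rightarrow> complex"
  assumes inv: "invariant_under composition_group P" and hom: "homeomorphism UNIV UNIV \<phi> \<psi>"
  shows "P (Bcontfun (\<lambda>x. apply_bcontfun f (\<phi> x))) = P f"
proof -
  have "continuous_on UNIV (\<lambda>x. apply_bcontfun f (\<phi> x))" for f :: "tshape \<Rightarrow>\<^sub>C complex"
    using hom by (intro continuous_on_compose2[OF continuous_on_apply_bcontfun])
      (auto simp: homeomorphism_def)
  then have "(\<lambda>f. Bcontfun (\<lambda>x. apply_bcontfun f (\<phi> x))) \<in> composition_group"
    using hom unfolding composition_group_def
    by (auto simp: apply_Bcontfun_tshape fun_eq_iff)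
  then have "P \<circ> (\<lambda>f. Bcontfun (\<lambda>x. apply_bcontfun f (\<phi> x))) = P"
    using inv unfolding invariant_under_def by blast
  then show ?thesis by (metis comp_apply)
qed

text \<open>A monotone surjection of the edge is a uniform limit of increasing homeomorphisms.\<close>

lemma invariant_reparam:
  fixes P :: "(tshape \<Rightarrow>\<^sub>C complex) \<Rightarrow> complex"
  assumes P: "continuous_polynomial P" and inv: "invariant_under composition_group P"
    and "edge_map v \<theta>"
    and k: "\<And>x. apply_bcontfun k x = apply_bcontfun f (edge_reparam v \<theta> x)"
  shows "P k = P f"
proof (rule ccontr)
  interpret edge_map v \<theta> by fact
  assume "P k \<noteq> P f"
  then have "dist (P f) (P k) > 0" by simp
  then obtain \<delta> where \<delta>: "\<delta> > 0" "\<And>u. dist u k < \<delta> \<Longrightarrow> dist (P u) (P k) < dist (P f) (P k)"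
    using continuous_polynomial_continuous[OF P] unfolding continuous_on_iff
    by (metis UNIV_I)
  have "uniformly_continuous_on UNIV (apply_bcontfun f)"
    by (intro compact_uniformly_continuous compact_tshape) simp
  then obtain \<epsilon> where \<epsilon>: "\<epsilon> > 0" "\<And>x y. dist y x < \<epsilon> \<Longrightarrow> dist (f y) (f x) < \<delta> / 2"
    unfolding uniformly_continuous_on_def using \<delta>(1) half_gt_zero by (metis UNIV_I)
  \<comment> \<open>Mixing the identity into \<open>\<theta>\<close> with weight \<open>s\<close>
    makes it strictly increasing and moves each value by at most \<open>s\<close>, which is below
    the modulus \<open>\<epsilon>\<close> of uniform continuity of \<open>f\<close>.\<close>
  define s where "s = min (1/2) (\<epsilon> / 2)"
  have s: "0 < s" "s < 1" "s < \<epsilon>" using \<epsilon>(1) by (auto simp: s_def)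
  define \<theta>' where "\<theta>' = (\<lambda>t. (1 - s) * \<theta> t + s * t)"
  have strict: "\<theta>' a < \<theta>' b" if "a \<in> {0..1}" "b \<in> {0..1}" "a < b" for a b
    using mono_onD[OF mono that(1,2)] that(3) s
    by (simp add: \<theta>'_def add_le_less_mono mult_left_mono)
  have em': "edge_map v \<theta>'"
  proof
    show "continuous_on {0..1} \<theta>'"
      unfolding \<theta>'_def by (intro continuous_intros cont)
    show "mono_on {0..1} \<theta>'"
      using strict by (intro mono_onI) (metis order.order_iff_strict)
  qed (auto simp: \<theta>'_def ends tip)
  have "inj_on \<theta>' {0..1}"
    using strict by (intro inj_onI) (metis linorder_neqE_linordered_idom order_less_irrefl)
  then obtain \<psi> where hom: "homeomorphism UNIV UNIV (edge_reparam v \<theta>') \<psi>"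
    using edge_map.homeomorphism_reparam[OF em'] by blast
  let ?u = "Bcontfun (\<lambda>x. apply_bcontfun f (edge_reparam v \<theta>' x))"
  have "dist ?u k \<le> \<delta> / 2"
  proof (rule dist_bound)
    fix x
    have "continuous_on UNIV (\<lambda>x. f (edge_reparam v \<theta>' x))"
      by (intro continuous_on_compose2[OF continuous_on_apply_bcontfun]
          edge_map.continuous_on_reparam[OF em']) auto
    then have u: "?u x = f (edge_reparam v \<theta>' x)"
      by (rule apply_Bcontfun_tshape)
    let ?t = "edge_coord v x"
    have t: "?t \<in> {0..1}" by (rule edge_coord_bounds[OF tip])
    have "dist (edge_reparam v \<theta>' x) (edge_reparam v \<theta> x) \<le> \<bar>\<theta>' ?t - \<theta> ?t\<bar>"
      using t range[OF t] edge_map.range[OF em' t] by (auto simp: edge_reparam_def dist_edge_pt tip)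
    also have "\<theta>' ?t - \<theta> ?t = s * (?t - \<theta> ?t)"
      by (simp add: \<theta>'_def algebra_simps)
    also have "\<bar>\<dots>\<bar> \<le> s * 1"
      unfolding abs_mult using s t range[OF t] by (intro mult_mono) auto
    finally have "dist (f (edge_reparam v \<theta>' x)) (f (edge_reparam v \<theta> x)) < \<delta> / 2"
      using s by (intro \<epsilon>) simp
    then show "dist (?u x) (k x) \<le> \<delta> / 2"
      by (simp add: u k)
  qed
  then have "dist (P ?u) (P k) < dist (P f) (P k)"
    using \<delta> by (intro \<delta>(2)) simp
  then show False
    using invariant_homeomorphism[OF inv hom, of f] by simp
qed


text \<open>The disjoint copies of \<open>h\<close> arise by composing it with maps that stretch one
  of \<open>N\<close> equal subarcs over the whole arc. These maps preserve \<open>u\<close>, which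
  is constant on the arc.\<close>

lemma invariant_edge_bump:
  fixes P :: "(tshape \<Rightarrow>\<^sub>C complex) \<Rightarrow> complex" and u h :: "tshape \<Rightarrow>\<^sub>C complex"
  assumes P: "continuous_polynomial P" and inv: "invariant_under composition_group P"
    and tip: "v \<in> tips" and \<alpha>\<beta>: "0 \<le> \<alpha>" "\<alpha> < \<beta>" "\<beta> \<le> 1"
    and u: "\<And>t. t \<in> {\<alpha>..\<beta>} \<Longrightarrow> u (edge_pt v t) = a"
    and h: "\<And>x. h x \<noteq> 0 \<Longrightarrow> edge_coord v x \<in> {\<alpha><..<\<beta>}"
  shows "P (u + h) = P u"
proof (rule continuous_polynomial_disjoint_copies[OF P])
  fix N :: nat
  \<comment> \<open>The first and last summands give the identity outside the arc. The middle one
    climbs from 0 to \<open>\<beta> - \<alpha>\<close> while \<open>t\<close> crosses the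
    \<open>i\<close>-th of \<open>N\<close> equal subarcs, counted from 0; for \<open>i < N\<close>
    the climb is complete at \<open>\<beta>\<close>.\<close>
  define \<theta> where "\<theta> = (\<lambda>(i::nat) t. min t \<alpha> +
    min (\<beta> - \<alpha>) (max 0 (N * (t - \<alpha>) - i * (\<beta> - \<alpha>))) + max 0 (t - \<beta>))"
  have below: "\<theta> i t = t" if "t \<le> \<alpha>" for i t
  proof -
    have "N * (t - \<alpha>) \<le> 0" "i * (\<beta> - \<alpha>) \<ge> 0"
      using that \<alpha>\<beta> by (auto intro: mult_nonneg_nonpos)
    then have "max 0 (N * (t - \<alpha>) - i * (\<beta> - \<alpha>)) = 0" by linarith
    then show ?thesis unfolding \<theta>_def using that \<alpha>\<beta> by linarith
  qed
  have above: "\<theta> i t = t" if "\<beta> \<le> t" "i < N" for i t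
  proof -
    have "(real i + 1) * (\<beta> - \<alpha>) \<le> N * (t - \<alpha>)"
      using that \<alpha>\<beta> by (intro mult_mono) auto
    then have "N * (t - \<alpha>) - i * (\<beta> - \<alpha>) \<ge> \<beta> - \<alpha>"
      by (simp add: algebra_simps)
    then show ?thesis using that \<alpha>\<beta> by (simp add: \<theta>_def)
  qed
  have between: "\<theta> i t \<in> {\<alpha>..\<beta>}" if "t \<in> {\<alpha>..\<beta>}" for i t
    using that by (auto simp: \<theta>_def)
  have em: "edge_map v (\<theta> i)" if "i < N" for i
  proof
    show "continuous_on {0..1} (\<theta> i)"
      unfolding \<theta>_def by (intro continuous_intros)
    show "mono_on {0..1} (\<theta> i)"
    proof (rule mono_onI)
      fix s t :: real assume "s \<le> t"
      then have "N * (s - \<alpha>) \<le> N * (t - \<alpha>)" by (intro mult_left_mono) auto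
      with \<open>s \<le> t\<close> show "\<theta> i s \<le> \<theta> i t"
        unfolding \<theta>_def by (intro add_mono min.mono max.mono) auto
    qed
  qed (use tip below above \<alpha>\<beta> that in auto)
  define k where "k = (\<lambda>i. Bcontfun (\<lambda>x. apply_bcontfun h (edge_reparam v (\<theta> i) x)))"
  have k: "k i x = h (edge_reparam v (\<theta> i) x)" if "i < N" for i x
  proof -
    have "continuous_on UNIV (\<lambda>x. h (edge_reparam v (\<theta> i) x))"
      by (intro continuous_on_compose2[OF continuous_on_apply_bcontfun]
          edge_map.continuous_on_reparam[OF em[OF that]]) auto
    then show ?thesis by (simp add: k_def apply_Bcontfun_tshape)
  qed
  have u_reparam: "u (edge_reparam v (\<theta> i) x) = u x" if "i < N" for i x
  proof (cases "edge_coord v x > 0")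
    case True
    let ?t = "edge_coord v x"
    have "u (edge_pt v (\<theta> i ?t)) = u (edge_pt v ?t)"
    proof (cases "?t \<in> {\<alpha>..\<beta>}")
      case True
      then show ?thesis using u between by simp
    next
      case False
      then show ?thesis using below above that by (cases "?t \<le> \<alpha>") auto
    qed
    with True show ?thesis by (simp add: edge_reparam_def edge_pt_edge_coord[OF tip])
  qed (simp add: edge_reparam_def)
  \<comment> \<open>The \<open>i\<close>-th copy lives in the \<open>i\<close>-th open subarc; the
    bounds are multiplied by \<open>N\<close> to avoid division.\<close>
  have support: "real i * (\<beta> - \<alpha>) < real N * (edge_coord v x - \<alpha>) \<and>
      real N * (edge_coord v x - \<alpha>) < (real i + 1) * (\<beta> - \<alpha>)" if "i < N" "k i x \<noteq> 0" for i x
  proof -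
    let ?t = "edge_coord v x"
    have "\<theta> i ?t \<in> {\<alpha><..<\<beta>}"
      using h[of "edge_reparam v (\<theta> i) x"] that
      by (simp add: k edge_map.edge_coord_reparam[OF em])
    moreover from this have "\<alpha> < ?t" "?t < \<beta>"
      using below[of ?t i] above[of ?t i] that(1) by force+
    ultimately show ?thesis
      by (auto simp: \<theta>_def min_def max_def algebra_simps split: if_splits)
  qed
  show "\<exists>k. (\<forall>i<N. \<forall>c. P (u + cscale c (k i)) = P (u + cscale c h)) \<and>
      (\<forall>i<N. norm (k i) \<le> norm h) \<and>
      (\<forall>x. \<forall>i<N. \<forall>j<N. k i x \<noteq> 0 \<longrightarrow> k j x \<noteq> 0 \<longrightarrow> i = j)"
  proof (intro exI[of _ k] conjI allI impI)
    fix i c assume i: "i < N"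
    \<comment> \<open>As \<open>u\<close> is unchanged, the left argument is
      \<open>u + cscale c h\<close> composed with the squeezing map.\<close>
    show "P (u + cscale c (k i)) = P (u + cscale c h)"
      by (rule invariant_reparam[OF P inv em[OF i]]) (simp add: u_reparam k i)
    show "norm (k i) \<le> norm h"
      by (rule norm_bound) (simp add: k i norm_bounded)
  next
    fix x i j assume ij: "i < N" "j < N" "k i x \<noteq> 0" "k j x \<noteq> 0"
    have "real i * (\<beta> - \<alpha>) < (real j + 1) * (\<beta> - \<alpha>)" "real j * (\<beta> - \<alpha>) < (real i + 1) * (\<beta> - \<alpha>)"
      using support[OF ij(1,3)] support[OF ij(2,4)] by linarith+
    then have "real i < real j + 1" "real j < real i + 1"
      using \<alpha>\<beta> by (simp_all add: mult_less_cancel_right)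
    then show "i = j" by linarith
  qed
qed


section \<open>Replacing a function on one edge\<close>

definition set_edge :: "complex \<Rightarrow> (tshape \<Rightarrow>\<^sub>C complex) \<Rightarrow> (real \<Rightarrow> complex) \<Rightarrow> (tshape \<Rightarrow>\<^sub>C complex)" where
  "set_edge v g p = Bcontfun (\<lambda>x. if edge_coord v x > 0 then p (edge_coord v x) else g x)"

lemma apply_set_edge:
  fixes g :: "tshape \<Rightarrow>\<^sub>C complex"
  assumes "v \<in> tips" "path p" "pathstart p = g (Abs_tshape 0)"
  shows "set_edge v g p x = (if edge_coord v x > 0 then p (edge_coord v x) else g x)"
proof -
  \<comment> \<open>Written as \<open>g\<close> plus a correction that vanishes at coordinate 0, the
    function is visibly continuous across the branch point.\<close>
  have "continuous_on UNIV (\<lambda>x. g x + (p (edge_coord v x) - g (edge_pt v (edge_coord v x))))"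
    using assms edge_coord_bounds[OF assms(1)] unfolding path_def
    by (intro continuous_intros continuous_on_compose2[OF _ continuous_on_edge_coord]
        continuous_on_compose2[OF continuous_on_apply_bcontfun] continuous_on_edge_pt
        continuous_on_compose2[OF continuous_on_edge_pt continuous_on_edge_coord]) auto
  also have "(\<lambda>x. g x + (p (edge_coord v x) - g (edge_pt v (edge_coord v x)))) =
      (\<lambda>x. if edge_coord v x > 0 then p (edge_coord v x) else g x)"
  proof
    fix x
    show "g x + (p (edge_coord v x) - g (edge_pt v (edge_coord v x))) =
        (if edge_coord v x > 0 then p (edge_coord v x) else g x)"
    proof (cases "edge_coord v x > 0")
      case False
      then have "edge_coord v x = 0" using edge_coord_bounds[OF assms(1), of x] by auto
      then show ?thesis using assms(3) by (simp add: edge_pt_0 pathstart_def)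
    qed (simp add: edge_pt_edge_coord assms(1))
  qed
  finally show ?thesis by (simp add: set_edge_def apply_Bcontfun_tshape)
qed

lemma set_edge_edge_pt:
  fixes g :: "tshape \<Rightarrow>\<^sub>C complex"
  assumes "v \<in> tips" "path p" "pathstart p = g (Abs_tshape 0)" "t \<in> {0..1}"
  shows "set_edge v g p (edge_pt v t) = p t"
proof (cases "t = 0")
  case True
  then have "set_edge v g p (edge_pt v t) = g (edge_pt v 0)"
    using assms by (simp add: apply_set_edge edge_coord_edge_pt)
  then show ?thesis using assms True by (simp add: edge_pt_0 pathstart_def)
qed (use assms in \<open>simp add: apply_set_edge edge_coord_edge_pt\<close>)

section \<open>Calculus of paths along one edge, modulo an invariant polynomial\<close>

locale invariant_polynomial =
  fixes P :: "(tshape \<Rightarrow>\<^sub>C complex) \<Rightarrow> complex" and v :: complex and g :: "tshape \<Rightarrow>\<^sub>C complex"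
  assumes P: "continuous_polynomial P" and inv: "invariant_under composition_group P"
    and tip: "v \<in> tips"
begin

abbreviation "start \<equiv> apply_bcontfun g (Abs_tshape 0)"

text \<open>Reparametrizing the path amounts to composing the whole function with
  \<open>edge_reparam\<close>. Concatenation rules therefore reduce to exhibiting a suitable
  \<open>\<theta>\<close>.\<close>

lemma set_edge_reparam:
  assumes "edge_map v \<theta>" "path p" "pathstart p = start"
    and q: "\<And>t. t \<in> {0..1} \<Longrightarrow> q t = p (\<theta> t)"
  shows "P (set_edge v g q) = P (set_edge v g p)"
proof (rule invariant_reparam[OF P inv assms(1)])
  interpret edge_map v \<theta> by fact
  have "path (p \<circ> \<theta>)" unfolding path_def
    using range by (intro continuous_on_compose cont continuous_on_subset[OF assms(2)[unfolded path_def]]) auto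
  then have "path q" unfolding path_def
    by (rule continuous_on_eq) (simp add: q)
  moreover have "pathstart q = start" using assms(3) ends by (simp add: pathstart_def q)
  ultimately have sq: "set_edge v g q x = (if edge_coord v x > 0 then q (edge_coord v x) else g x)" for x
    by (intro apply_set_edge tip)
  show "set_edge v g q x = set_edge v g p (edge_reparam v \<theta> x)" for x
  proof (cases "edge_coord v x > 0")
    case True
    have t: "edge_coord v x \<in> {0..1}" by (rule edge_coord_bounds[OF tip])
    from True show ?thesis
      by (simp add: sq q[OF t] edge_reparam_def set_edge_edge_pt[OF tip assms(2,3) range[OF t]])
  next
    case False
    then show ?thesis using assms by (simp add: sq edge_reparam_def apply_set_edge tip)
  qed
qed

lemma join_const:
  assumes "path p" "pathstart p = start"
  shows "P (set_edge v g (p +++ (\<lambda>_. pathfinish p))) = P (set_edge v g p)"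
proof (rule set_edge_reparam[OF _ assms])
  show "edge_map v (\<lambda>t. min (2 * t) 1)"
    by unfold_locales (auto intro!: continuous_intros mono_onI tip)
qed (auto simp: joinpaths_def pathfinish_def min_def)

lemma const_join:
  assumes "path p" "pathstart p = start"
  shows "P (set_edge v g ((\<lambda>_. pathstart p) +++ p)) = P (set_edge v g p)"
proof (rule set_edge_reparam[OF _ assms])
  show "edge_map v (\<lambda>t. max 0 (2 * t - 1))"
    by unfold_locales (auto intro!: continuous_intros mono_onI tip)
  show "((\<lambda>_. pathstart p) +++ p) t = p (max 0 (2 * t - 1))" for t
    by (cases "t \<le> 1/2") (simp_all add: joinpaths_def pathstart_def max_absorb1 max_absorb2)
qed

lemma join_assoc:
  assumes "path p" "path q" "path r" "pathstart p = start"
    and "pathfinish p = pathstart q" "pathfinish q = pathstart r"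
  shows "P (set_edge v g (p +++ (q +++ r))) = P (set_edge v g ((p +++ q) +++ r))"
proof (rule set_edge_reparam)
  \<comment> \<open>The piecewise linear change of time between the two bracketings: slopes 1/2, 1
    and 2, with breaks at 1/2 and 3/4. Its convexity allows it to be written as a maximum.\<close>
  show "edge_map v (\<lambda>t. max (t / 2) (max (t - 1/4) (2 * t - 1)))"
  proof
    show "mono_on {0..1} (\<lambda>t::real. max (t / 2) (max (t - 1/4) (2 * t - 1)))"
      by (intro mono_onI max.mono) auto
  qed (auto intro!: continuous_intros tip)
  show "(p +++ (q +++ r)) t = ((p +++ q) +++ r) (max (t / 2) (max (t - 1/4) (2 * t - 1)))"
    if "t \<in> {0..1}" for t
  proof -
    consider "t \<le> 1/2" | "1/2 < t" "t \<le> 3/4" | "3/4 < t" by linarith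
    then show ?thesis
    proof cases
      case 1
      then have "max (t / 2) (max (t - 1/4) (2 * t - 1)) = t / 2" by auto
      then show ?thesis using 1 by (simp add: joinpaths_def)
    next
      case 2
      then have "max (t / 2) (max (t - 1/4) (2 * t - 1)) = t - 1/4" by auto
      then show ?thesis using 2 by (simp add: joinpaths_def algebra_simps)
    next
      case 3
      then have "max (t / 2) (max (t - 1/4) (2 * t - 1)) = 2 * t - 1" by auto
      then show ?thesis using 3 by (simp add: joinpaths_def algebra_simps)
    qed
  qed
qed (use assms in auto)

text \<open>The two functions differ by a bump on the first half of the edge, where the second one
  is constant. The bump vanishes at 1/2 because the loop closes.\<close>

lemma loop_at_start:
  assumes l: "path l" "pathstart l = start" "pathfinish l = start"
    and p: "path p" "pathstart p = start"
  shows "P (set_edge v g (l +++ p)) = P (set_edge v g ((\<lambda>_. start) +++ p))"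
proof -
  let ?c = "(\<lambda>_. start) +++ p"
  have "path (\<lambda>_. start)" "pathfinish (\<lambda>_. start) = start"
    by (simp_all add: path_def pathfinish_def)
  then have c: "path ?c" "pathstart ?c = start"
    using p by (simp_all add: path_join_imp) (simp add: pathstart_def)
  have lp: "path (l +++ p)" "pathstart (l +++ p) = start"
    using l p by auto
  define h where "h = set_edge v g (l +++ p) - set_edge v g ?c"
  have "P (set_edge v g ?c + h) = P (set_edge v g ?c)"
  proof (rule invariant_edge_bump[OF P inv tip, of 0 "1/2" _ start])
    show "set_edge v g ?c (edge_pt v t) = start" if "t \<in> {0..1/2}" for t
    proof -
      have "set_edge v g ?c (edge_pt v t) = ?c t"
        using that by (intro set_edge_edge_pt tip c) auto
      also have "\<dots> = start" using that by (simp add: joinpaths_def)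
      finally show ?thesis .
    qed
    show "edge_coord v x \<in> {0<..<1/2}" if "h x \<noteq> 0" for x
    proof -
      let ?t = "edge_coord v x"
      have "?t > 0" "(l +++ p) ?t \<noteq> ?c ?t"
        using that by (auto simp: h_def apply_set_edge[OF tip c] apply_set_edge[OF tip lp] split: if_splits)
      moreover have "?t \<noteq> 1/2"
      proof
        assume "?t = 1/2"
        with \<open>(l +++ p) ?t \<noteq> ?c ?t\<close> show False
          using l(3) by (simp add: joinpaths_def pathfinish_def)
      qed
      ultimately show ?thesis by (auto simp: joinpaths_def split: if_splits)
    qed
  qed auto
  then show ?thesis by (simp add: h_def)
qed

text \<open>The mirror image on the second half. Closing of the loop now makes the bump vanish at
  the tip, coordinate 1.\<close>

lemma loop_at_finish:
  assumes p: "path p" "pathstart p = start"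
    and l: "path l" "pathstart l = pathfinish p" "pathfinish l = pathfinish p"
  shows "P (set_edge v g (p +++ l)) = P (set_edge v g (p +++ (\<lambda>_. pathfinish p)))"
proof -
  let ?c = "p +++ (\<lambda>_. pathfinish p)"
  have "path (\<lambda>_. pathfinish p)" "pathstart (\<lambda>_. pathfinish p) = pathfinish p"
    by (simp_all add: path_def pathstart_def)
  then have c: "path ?c" "pathstart ?c = start"
    using p by (simp_all add: path_join_imp)
  have pl: "path (p +++ l)" "pathstart (p +++ l) = start"
    using l p by auto
  define h where "h = set_edge v g (p +++ l) - set_edge v g ?c"
  have "P (set_edge v g ?c + h) = P (set_edge v g ?c)"
  proof (rule invariant_edge_bump[OF P inv tip, of "1/2" 1 _ "pathfinish p"])
    show "set_edge v g ?c (edge_pt v t) = pathfinish p" if "t \<in> {1/2..1}" for t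
    proof -
      have "set_edge v g ?c (edge_pt v t) = ?c t"
        using that by (intro set_edge_edge_pt tip c) auto
      also have "\<dots> = pathfinish p"
      \<comment> \<open>At 1/2 the concatenation still takes its value from \<open>p\<close>, namely
        the end value of \<open>p\<close>.\<close>
      proof (cases "t = 1/2")
        case True
        show ?thesis by (simp add: True joinpaths_def pathfinish_def)
      qed (use that in \<open>auto simp: joinpaths_def\<close>)
      finally show ?thesis .
    qed
    show "edge_coord v x \<in> {1/2<..<1}" if "h x \<noteq> 0" for x
    proof -
      let ?t = "edge_coord v x"
      have ne: "(p +++ l) ?t \<noteq> ?c ?t"
        using that by (auto simp: h_def apply_set_edge[OF tip c] apply_set_edge[OF tip pl] split: if_splits)
      moreover have "?t \<noteq> 1"
      proof
        assume "?t = 1"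
        with ne show False
          using l(3) by (simp add: joinpaths_def pathfinish_def)
      qed
      moreover have "?t \<le> 1" using edge_coord_bounds[OF tip, of x] by simp
      ultimately show ?thesis by (auto simp: joinpaths_def split: if_splits)
    qed
  qed auto
  then show ?thesis by (simp add: h_def)
qed

text \<open>Insert the loop \<open>p\<inverse> q\<close> after \<open>p\<close>, then delete the loop \<open>p p\<inverse>\<close> before \<open>q\<close>.\<close>

lemma set_edge_same_ends:
  assumes p: "path p" "pathstart p = start" and q: "path q" "pathstart q = start"
    and "pathfinish p = pathfinish q"
  shows "P (set_edge v g p) = P (set_edge v g q)"
proof -
  have "P (set_edge v g p) = P (set_edge v g (p +++ (\<lambda>_. pathfinish p)))"
    using join_const[OF p] by simp
  also have "\<dots> = P (set_edge v g (p +++ (reversepath p +++ q)))"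
    using assms by (intro loop_at_finish[symmetric]) auto
  also have "\<dots> = P (set_edge v g ((p +++ reversepath p) +++ q))"
    using assms by (intro join_assoc) auto
  also have "\<dots> = P (set_edge v g ((\<lambda>_. start) +++ q))"
    using assms by (intro loop_at_start) auto
  also have "\<dots> = P (set_edge v g q)"
    using const_join[OF q] q(2) by simp
  finally show ?thesis .
qed

text \<open>The values along the edge are replaced by the straight segment between the two end
  values, which stays in the convex unit disc.\<close>

lemma invariant_bounded_edge:
  assumes "cmod start \<le> 1" "cmod (g (edge_pt v 1)) \<le> 1"
  obtains g' where "P g' = P g" "\<And>x. edge_coord v x > 0 \<Longrightarrow> cmod (g' x) \<le> 1"
    and "\<And>x. edge_coord v x = 0 \<Longrightarrow> g' x = g x"
proof -
  let ?p = "\<lambda>t. g (edge_pt v t)"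
  have p: "path ?p" "pathstart ?p = start" "pathfinish ?p = g (edge_pt v 1)"
    unfolding path_def pathstart_def pathfinish_def
    by (auto simp: edge_pt_0 intro!: continuous_on_compose2[OF continuous_on_apply_bcontfun]
        continuous_on_edge_pt tip)
  let ?q = "linepath start (g (edge_pt v 1))"
  have q: "path ?q" "pathstart ?q = start" by auto
  have "set_edge v g ?p = g"
    by (rule bcontfun_eqI) (simp add: apply_set_edge[OF tip p(1,2)] edge_pt_edge_coord[OF tip])
  then have "P (set_edge v g ?q) = P g"
    using set_edge_same_ends[OF q p(1,2)] p(3) by simp
  moreover have "cmod (set_edge v g ?q x) \<le> 1" if "edge_coord v x > 0" for x
  proof -
    have "closed_segment start (g (edge_pt v 1)) \<subseteq> cball 0 1"
      using assms by (intro closed_segment_subset convex_cball) auto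
    moreover have "?q (edge_coord v x) \<in> closed_segment start (g (edge_pt v 1))"
      using edge_coord_bounds[OF tip, of x] linepath_in_path by auto
    ultimately show ?thesis
      using that by (auto simp: apply_set_edge tip)
  qed
  moreover have "set_edge v g ?q x = g x" if "edge_coord v x = 0" for x
    using that by (simp add: apply_set_edge tip)
  ultimately show thesis by (rule that)
qed

end

text \<open>The edges are straightened one after another. The induction records that the function
  still agrees with \<open>g\<close> off the edges already treated and at the branch point.\<close>

lemma invariant_bounded_representative:
  fixes g :: "tshape \<Rightarrow>\<^sub>C complex"
  assumes P: "continuous_polynomial P" and inv: "invariant_under composition_group P"
    and g: "cmod (g (Abs_tshape 0)) \<le> 1" "\<And>v. v \<in> tips \<Longrightarrow> cmod (g (Abs_tshape v)) \<le> 1"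
  obtains f where "P f = P g" "f \<in> cball 0 1"
proof -
  have tip_pt: "edge_pt v 1 = Abs_tshape v" for v by (simp add: edge_pt_def)
  have ip: "invariant_polynomial P v" if "v \<in> tips" for v
    using P inv that by unfold_locales
  have "\<exists>f. P f = P g \<and> (\<forall>x. (\<exists>v\<in>V. edge_coord v x > 0) \<longrightarrow> cmod (f x) \<le> 1) \<and>
      (\<forall>x. (\<forall>v\<in>V. edge_coord v x = 0) \<longrightarrow> f x = g x)"
    if "finite V" "V \<subseteq> tips" for V
    using that
  proof (induction V rule: finite_induct)
    case empty
    show ?case by (rule exI[of _ g]) simp
  next
    case (insert v V)
    then obtain f where f: "P f = P g" "\<And>x. \<exists>w\<in>V. edge_coord w x > 0 \<Longrightarrow> cmod (f x) \<le> 1"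
        "\<And>x. \<forall>w\<in>V. edge_coord w x = 0 \<Longrightarrow> f x = g x"
      by auto
    have v: "v \<in> tips" using insert.prems by simp
    \<comment> \<open>Both ends of the new edge have coordinate 0 on the treated edges, so their
      values are still those of \<open>g\<close> and hence bounded by 1.\<close>
    have "edge_coord w (edge_pt v 1) = 0" "edge_coord w (edge_pt v 0) = 0" if "w \<in> V" for w
      using insert v that by (auto simp: edge_coord_edge_pt)
    then have fv: "f (edge_pt v 1) = g (edge_pt v 1)" "f (edge_pt v 0) = g (edge_pt v 0)"
      by (auto intro: f(3))
    then obtain f' where f': "P f' = P f" "\<And>x. edge_coord v x > 0 \<Longrightarrow> cmod (f' x) \<le> 1"
        "\<And>x. edge_coord v x = 0 \<Longrightarrow> f' x = f x"
      using invariant_polynomial.invariant_bounded_edge[OF ip[OF v], of f] g(1) g(2)[OF v]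
      by (auto simp: tip_pt edge_pt_0)
    have zero: "edge_coord v x = 0" if "\<not> edge_coord v x > 0" for x
      using that edge_coord_bounds[OF v, of x] by auto
    show ?case
    proof (intro exI[of _ f'] conjI allI impI)
      show "P f' = P g" using f f' by simp
      show "cmod (f' x) \<le> 1" if "\<exists>w\<in>insert v V. edge_coord w x > 0" for x
        using that f(2) f'(2,3) zero by (cases "edge_coord v x > 0") auto
      show "f' x = g x" if "\<forall>w\<in>insert v V. edge_coord w x = 0" for x
        using that f(3) f'(3) by auto
    qed
  qed
  from this[of tips] obtain f where f: "P f = P g"
      "\<And>x. \<exists>v\<in>tips. edge_coord v x > 0 \<Longrightarrow> cmod (f x) \<le> 1"
      "\<And>x. \<forall>v\<in>tips. edge_coord v x = 0 \<Longrightarrow> f x = g x"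
    by (auto simp: tips_def)
  have "cmod (f x) \<le> 1" for x
  proof (cases x rule: tshape_cases)
    case (1 v t)
    show ?thesis
    proof (cases "t = 0")
      case True
      then have "f x = g x" using 1 by (intro f(3)) (auto simp: edge_coord_edge_pt)
      then show ?thesis using True 1 g(1) by (simp add: edge_pt_0)
    next
      case False
      then show ?thesis using 1 by (intro f(2)) (auto simp: edge_coord_edge_pt intro!: bexI[of _ v])
    qed
  qed
  then have "norm f \<le> 1" by (rule norm_bound)
  then show thesis using that f(1) by (auto simp: dist_norm)
qed


section \<open>Homeomorphisms of the T-shape\<close>

text \<open>Edges are radial, so the image of \<open>S\<close> in the plane is starlike about
  0.\<close>

lemma connected_starlike_tshape:
  assumes "Abs_tshape 0 \<in> S"
    and "\<And>v s t. v \<in> tips \<Longrightarrow> t \<in> {0..1} \<Longrightarrow> s \<in> {0..t} \<Longrightarrow> edge_pt v t \<in> S \<Longrightarrow> edge_pt v s \<in> S"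
  shows "connected S"
proof -
  have "starlike (Rep_tshape ` S)"
    unfolding starlike_def
  proof (intro bexI[of _ 0] ballI subsetI)
    fix z y assume z: "z \<in> Rep_tshape ` S" and y: "y \<in> closed_segment 0 z"
    obtain x where x: "x \<in> S" "z = Rep_tshape x" using z by blast
    obtain v t where vt: "v \<in> tips" "t \<in> {0..1}" "x = edge_pt v t"
      by (rule tshape_cases)
    obtain r where r: "0 \<le> r" "r \<le> 1" "y = r *\<^sub>R z"
      using y by (auto simp: closed_segment_def)
    have rt: "r * t \<in> {0..t}" using r vt(2) by (auto intro: mult_left_le_one_le)
    then have "y = Rep_tshape (edge_pt v (r * t))"
      using r vt x by (simp add: Rep_edge_pt scaleR_conv_of_real)
    then show "y \<in> Rep_tshape ` S"
      using assms(2)[OF vt(1,2) rt] x vt by simp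
  next
    show "0 \<in> Rep_tshape ` S" using imageI[OF assms(1), of Rep_tshape] by (simp add: Abs_tshape_inverse)
  qed
  then have "connected (Rep_tshape ` S)" by (rule starlike_imp_connected)
  moreover have "continuous_on tshape_set Abs_tshape"
    using homeomorphism_tshape by (simp add: homeomorphism_def)
  then have "continuous_on (Rep_tshape ` S) Abs_tshape"
    by (rule continuous_on_subset) (simp add: image_subset_iff Rep_tshape)
  ultimately have "connected (Abs_tshape ` Rep_tshape ` S)"
    by (intro connected_continuous_image[of "Rep_tshape ` S"])
  then show ?thesis by (simp add: image_image Rep_tshape_inverse)
qed

lemma connected_real_zero:
  fixes f :: "'a::topological_space \<Rightarrow> real"
  assumes "connected S" "continuous_on S f" "x \<in> S" "y \<in> S" "f x \<le> 0" "0 \<le> f y"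
  obtains z where "z \<in> S" "f z = 0"
proof -
  have "connected (f ` S)" using assms by (intro connected_continuous_image)
  then have "0 \<in> f ` S"
    using assms connected_contains_Icc[of "f ` S" "f x" "f y"] by force
  then show thesis using that by force
qed

text \<open>The function \<open>?f\<close> equals the distance from 0 on the edge of
  \<open>v\<close> and its negative on the others. It changes sign between the two tips and vanishes
  only at the branch point.\<close>

lemma connected_two_tips:
  assumes "connected S" "v \<in> tips" "w \<in> tips" "v \<noteq> w" "Abs_tshape v \<in> S" "Abs_tshape w \<in> S"
  shows "Abs_tshape 0 \<in> S"
proof -
  let ?f = "\<lambda>x. 2 * edge_coord v x - cmod (Rep_tshape x)"
  have pt: "Abs_tshape u = edge_pt u 1" for u by (simp add: edge_pt_def)
  have cont: "continuous_on S ?f"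
    by (intro continuous_intros continuous_on_edge_coord continuous_on_Rep_tshape)
  have "?f (Abs_tshape w) \<le> 0" "0 \<le> ?f (Abs_tshape v)"
    unfolding pt using assms(2-4) by (simp_all add: edge_coord_edge_pt Rep_edge_pt tips_norm)
  from connected_real_zero[OF assms(1) cont assms(6,5) this]
  obtain x where x: "x \<in> S" "?f x = 0" .
  obtain u t where ut: "u \<in> tips" "t \<in> {0..1}" "x = edge_pt u t"
    by (rule tshape_cases)
  then have "t = 0" using x(2) assms(2)
    by (auto simp: edge_coord_edge_pt Rep_edge_pt norm_mult tips_norm split: if_splits)
  then show ?thesis using x ut by (simp add: edge_pt_0)
qed

text \<open>The tips are the non-cut points, a property invariant under homeomorphisms. Deleting a
  tip leaves a star; deleting 0 separates two tips, and deleting an inner point of an edge separates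
  its tip from 0.\<close>

lemma connected_delete_iff: "connected (UNIV - {x}) \<longleftrightarrow> x \<in> Abs_tshape ` tips"
proof
  assume "x \<in> Abs_tshape ` tips"
  then obtain v where v: "v \<in> tips" "x = edge_pt v 1" by (auto simp: edge_pt_def)
  show "connected (UNIV - {x})"
  proof (rule connected_starlike_tshape)
    show "Abs_tshape 0 \<in> UNIV - {x}"
      using edge_coord_edge_pt[OF v(1) v(1), of 0] edge_coord_edge_pt[OF v(1) v(1), of 1] v(2)
      by (auto simp: edge_pt_0)
    fix w s t assume w: "w \<in> tips" "t \<in> {0..1::real}" "s \<in> {0..t}" "edge_pt w t \<in> UNIV - {x}"
    show "edge_pt w s \<in> UNIV - {x}"
    proof -
      have "edge_pt w s \<noteq> x"
      proof
        assume "edge_pt w s = x"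
        then have "edge_coord v (edge_pt w s) = 1"
          using v by (simp add: edge_coord_edge_pt)
        then have "w = v" "s = 1" using v w
          by (auto simp: edge_coord_edge_pt split: if_splits)
        then show False using w v by auto
      qed
      then show ?thesis by simp
    qed
  qed
next
  assume conn: "connected (UNIV - {x})"
  obtain v t where vt: "v \<in> tips" "t \<in> {0..1}" "x = edge_pt v t"
    by (rule tshape_cases)
  show "x \<in> Abs_tshape ` tips"
  proof (rule ccontr)
    assume not_tip: "x \<notin> Abs_tshape ` tips"
    then have "t \<noteq> 1" using vt by (auto simp: edge_pt_def)
    have tip_ne: "Abs_tshape u \<in> UNIV - {x}" if "u \<in> tips" for u
      using not_tip that by blast
    show False
    proof (cases "t = 0")
      case True
      have "Abs_tshape 0 \<in> UNIV - {x}"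
        using connected_two_tips[OF conn, of 1 "-1"] tip_ne[of 1] tip_ne[of "-1"]
        by (simp add: tips_def)
      then show False using True vt by (simp add: edge_pt_0)
    next
      case False
      have "edge_pt v 0 \<noteq> edge_pt v t"
        using edge_coord_edge_pt[OF vt(1) vt(1), of 0] edge_coord_edge_pt[OF vt(1,1,2)] False by auto
      then have p0: "edge_pt v 0 \<in> UNIV - {x}" using vt(3) by simp
      have p1: "edge_pt v 1 \<in> UNIV - {x}"
        using tip_ne[OF vt(1)] by (simp add: edge_pt_def)
      have le: "edge_coord v (edge_pt v 0) - t \<le> 0" and ge: "0 \<le> edge_coord v (edge_pt v 1) - t"
        using vt by (simp_all add: edge_coord_edge_pt)
      have cont: "continuous_on (UNIV - {x}) (\<lambda>x. edge_coord v x - t)"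
        by (intro continuous_intros continuous_on_edge_coord)
      obtain z where z: "z \<in> UNIV - {x}" "edge_coord v z - t = 0"
        by (rule connected_real_zero[OF conn cont p0 p1 le ge])
      then have "edge_pt v t = z"
        using edge_pt_edge_coord[OF vt(1), of z] False vt(2) by auto
      then show False using z vt by simp
    qed
  qed
qed

lemma inj_on_Abs_tshape_tips: "inj_on Abs_tshape tips"
proof (rule inj_onI)
  fix v w assume vw: "v \<in> tips" "w \<in> tips" "Abs_tshape v = Abs_tshape w"
  then have "edge_pt v 1 = edge_pt w 1" by (simp add: edge_pt_def)
  then show "v = w"
    using edge_coord_edge_pt[OF vw(1,1), of 1] edge_coord_edge_pt[OF vw(1,2), of 1]
    by (auto split: if_splits)
qed

context
  fixes \<phi> \<psi> :: "tshape \<Rightarrow> tshape"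
  assumes hom: "homeomorphism UNIV UNIV \<phi> \<psi>"
begin

lemma bij_betw_tips: "bij_betw \<phi> (Abs_tshape ` tips) (Abs_tshape ` tips)"
proof -
  have inj: "inj \<phi>" using hom unfolding homeomorphism_def by (metis UNIV_I injI)
  have "\<phi> x \<in> Abs_tshape ` tips" if "x \<in> Abs_tshape ` tips" for x
  proof -
    have "\<phi> ` (UNIV - {x}) = UNIV - {\<phi> x}"
      using hom inj by (simp add: homeomorphism_def image_set_diff)
    moreover have "continuous_on (UNIV - {x}) \<phi>"
      using hom continuous_on_subset unfolding homeomorphism_def by blast
    ultimately show ?thesis
      using that connected_continuous_image[of "UNIV - {x}" \<phi>] by (simp add: connected_delete_iff)
  qed
  then have "\<phi> ` Abs_tshape ` tips \<subseteq> Abs_tshape ` tips" by blast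
  moreover have "finite (Abs_tshape ` tips)" by (simp add: tips_def)
  moreover have "inj_on \<phi> (Abs_tshape ` tips)" using inj by (rule inj_on_subset) simp
  ultimately show ?thesis unfolding bij_betw_def by (metis endo_inj_surj)
qed

text \<open>If 0 were sent into the edge of \<open>v\<close>, away from 0, the union
  \<open>S\<close> of the other two edges would miss the image of 0. But the preimage of
  \<open>S\<close> is connected and contains two tips, hence contains 0.\<close>

lemma homeomorphism_fixes_0: "\<phi> (Abs_tshape 0) = Abs_tshape 0"
proof (rule ccontr)
  assume ne: "\<phi> (Abs_tshape 0) \<noteq> Abs_tshape 0"
  obtain v t where vt: "v \<in> tips" "t \<in> {0..1}" "\<phi> (Abs_tshape 0) = edge_pt v t"
    by (rule tshape_cases)
  with ne have "t \<noteq> 0" by (auto simp: edge_pt_0)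
  define S where "S = {x. edge_coord v x = 0}"
  have "connected S"
    by (rule connected_starlike_tshape)
      (use vt in \<open>auto simp: S_def edge_coord_edge_pt edge_pt_0[of v, symmetric] split: if_splits\<close>)
  moreover have "continuous_on S \<psi>"
    using hom continuous_on_subset unfolding homeomorphism_def by blast
  ultimately have conn: "connected (\<psi> ` S)" by (intro connected_continuous_image)
  obtain a b where ab: "a \<in> tips" "b \<in> tips" "a \<noteq> b" "a \<noteq> v" "b \<noteq> v"
  proof -
    have "v = 1 \<or> v = -1 \<or> v = \<i>" using vt(1) by (simp add: tips_def)
    moreover have "(1::complex) \<noteq> -1" "1 \<noteq> \<i>" "-1 \<noteq> \<i>" by (auto simp: complex_eq_iff)
    ultimately show thesis using that unfolding tips_def by (metis insertCI)
  qed
  have S: "Abs_tshape u \<in> S" if "u \<in> tips" "u \<noteq> v" for u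
    using edge_coord_edge_pt[OF vt(1) that(1), of 1] that(2) by (simp add: S_def edge_pt_def)
  have "\<exists>u'\<in>tips. \<psi> (Abs_tshape u) = Abs_tshape u'" if "u \<in> tips" for u
  proof -
    have "Abs_tshape u \<in> \<phi> ` Abs_tshape ` tips"
      using bij_betw_tips that by (simp add: bij_betw_def)
    then show ?thesis using hom by (auto simp: homeomorphism_def)
  qed
  then obtain a' b' where ab': "a' \<in> tips" "\<psi> (Abs_tshape a) = Abs_tshape a'"
      "b' \<in> tips" "\<psi> (Abs_tshape b) = Abs_tshape b'"
    using ab(1,2) by blast
  have "a' \<noteq> b'"
  proof
    assume "a' = b'"
    then have "Abs_tshape a = Abs_tshape b"
      using ab' hom unfolding homeomorphism_def by (metis UNIV_I)
    then show False using ab(1-3) inj_on_Abs_tshape_tips by (auto dest: inj_onD)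
  qed
  moreover have "Abs_tshape a' \<in> \<psi> ` S" "Abs_tshape b' \<in> \<psi> ` S"
    using imageI[OF S[OF ab(1,4)], of \<psi>] imageI[OF S[OF ab(2,5)], of \<psi>] ab'(2,4) by simp_all
  ultimately have "Abs_tshape 0 \<in> \<psi> ` S"
    by (rule connected_two_tips[OF conn ab'(1,3)])
  then have "\<phi> (Abs_tshape 0) \<in> S" using hom by (auto simp: homeomorphism_def)
  then show False using vt \<open>t \<noteq> 0\<close> by (simp add: S_def edge_coord_edge_pt)
qed

end


section \<open>Power sums of evaluations\<close>

text \<open>The form \<open>A\<close> replaces each power by a product of \<open>N\<close>
  independent evaluations; the homogeneous parts of degree below \<open>N\<close> are 0.\<close>

lemma continuous_polynomial_power_sum:
  fixes S :: "'a::topological_space set"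
  shows "continuous_polynomial (\<lambda>f. \<Sum>x\<in>S. apply_bcontfun f x ^ N)"
proof -
  have mult: "vector_space ((*) :: complex \<Rightarrow> complex \<Rightarrow> complex)"
    by unfold_locales (auto simp: algebra_simps)
  define A where "A = (\<lambda>u :: nat \<Rightarrow> 'a \<Rightarrow>\<^sub>C complex. \<Sum>x\<in>S. \<Prod>i<N. u i x)"
  have "Vector_Spaces.linear cscale (*) (\<lambda>f. A (u(i := f)))" if "i < N" for u i
  proof -
    have split: "(\<Prod>j<N. (u(i := f)) j x) = f x * (\<Prod>j\<in>{..<N} - {i}. u j x)"
      for f :: "'a \<Rightarrow>\<^sub>C complex" and x
    proof -
      have "(\<Prod>j<N. (u(i := f)) j x) = (u(i := f)) i x * (\<Prod>j\<in>{..<N} - {i}. (u(i := f)) j x)"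
        using that by (intro prod.remove) auto
      also have "(\<Prod>j\<in>{..<N} - {i}. (u(i := f)) j x) = (\<Prod>j\<in>{..<N} - {i}. u j x)"
        by (intro prod.cong) auto
      finally show ?thesis by simp
    qed
    show ?thesis
      unfolding Vector_Spaces.linear_iff A_def split
      by (auto simp: vector_space_cscale mult distrib_right sum.distrib sum_distrib_left mult.assoc)
  qed
  moreover have "continuous_on UNIV A"
    unfolding A_def
  proof (intro continuous_intros)
    fix x i
    have "continuous_on UNIV (\<lambda>f :: 'a \<Rightarrow>\<^sub>C complex. f x)"
      by (rule continuous_onI) (meson dist_fun_lt_imp_dist_val_lt order_less_imp_le)
    moreover have "continuous_on UNIV (\<lambda>u :: nat \<Rightarrow> 'a \<Rightarrow>\<^sub>C complex. u i)"
      by (rule continuous_on_product_coordinates)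
    ultimately show "continuous_on UNIV (\<lambda>u :: nat \<Rightarrow> 'a \<Rightarrow>\<^sub>C complex. u i x)"
      by (rule continuous_on_compose2) simp
  qed
  ultimately have A: "continuous_multilinear N A"
    unfolding continuous_multilinear_def by (auto simp: A_def)
  have zero: "continuous_homogeneous_polynomial k (\<lambda>_ :: 'a \<Rightarrow>\<^sub>C complex. 0)" for k
  proof -
    have "continuous_multilinear k (\<lambda>_ :: nat \<Rightarrow> 'a \<Rightarrow>\<^sub>C complex. 0)"
      by (simp add: continuous_multilinear_def Vector_Spaces.linear_iff vector_space_cscale mult)
    then show ?thesis
      unfolding continuous_homogeneous_polynomial_def by (intro exI[of _ "\<lambda>_. 0"]) simp
  qed
  let ?P = "\<lambda>f. \<Sum>x\<in>S. apply_bcontfun f x ^ N"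
  have "?P = (\<lambda>f. A (\<lambda>_. f))" by (simp add: A_def)
  then have "continuous_homogeneous_polynomial N ?P"
    unfolding continuous_homogeneous_polynomial_def using A by (intro exI[of _ A]) (simp add: A_def)
  with zero show ?thesis
    unfolding continuous_polynomial_def
    by (intro exI[of _ N] exI[of _ "\<lambda>k. if k = N then ?P else (\<lambda>_. 0)"]) (auto simp: if_distribR)
qed

text \<open>Simultaneous Dirichlet approximation brings the arguments of all \<open>z x ^ N\<close> close to \<open>0\<close>,
  so that no cancellation occurs.\<close>

lemma exists_large_power_sum:
  fixes z :: "'a \<Rightarrow> complex"
  assumes S: "finite S" "a \<in> S" "cmod (z a) > 1"
  shows "\<exists>N. cmod (\<Sum>x\<in>S. z x ^ N) > B"
proof -
  obtain m where m: "cmod (z a) ^ m > 2 * max B 1"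
    using real_arch_pow[OF S(3)] by blast
  obtain f n where f: "bij_betw f {..<n::nat} S"
    using ex_bij_betw_nat_finite[OF S(1)] by (auto simp: atLeast0LessThan)
  \<comment> \<open>Arguments of \<open>z x ^ m\<close>, in full turns. Starting from the power
    \<open>m\<close> makes \<open>N\<close> a multiple of \<open>m\<close>, so \<open>N\<close> is
    at least \<open>m\<close>.\<close>
  define \<theta> where "\<theta> = (\<lambda>i. m * Arg (z (f i)) / (2 * pi))"
  \<comment> \<open>An error below 1/6 of a turn is an angle below \<open>pi / 3\<close>, whose
    cosine is at least 1/2.\<close>
  obtain q p where q: "0 < q" "\<And>i. i < n \<Longrightarrow> \<bar>of_int q * \<theta> i - of_int (p i)\<bar> < 1 / 6"
  proof (rule Dirichlet_approx_simult[of 6 n \<theta>])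
    fix q p
    assume "0 < q" "\<And>i. i < n \<Longrightarrow> \<bar>of_int q * \<theta> i - of_int (p i)\<bar> < 1 / real 6"
    then show thesis using that[of q p] by simp
  qed auto
  define N where "N = m * nat q"
  have Re: "Re (z x ^ N) \<ge> cmod (z x) ^ N / 2" if x: "x \<in> S" for x
  proof -
    obtain i where i: "i < n" "x = f i" using f x by (auto simp: bij_betw_def)
    let ?\<alpha> = "of_int q * \<theta> i - of_int (p i)"
    have "N * Arg (z x) = 2 * pi * (of_int q * \<theta> i)"
      using q(1) i by (simp add: N_def \<theta>_def field_simps)
    also have "\<dots> = 2 * pi * ?\<alpha> + 2 * pi * of_int (p i)"
      by (simp add: algebra_simps)
    finally have arg: "cos (N * Arg (z x)) = cos (2 * pi * ?\<alpha>)"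
      by (simp only: cos_add cos_int_2pin sin_int_2pin mult_1_right mult_zero_right diff_zero)
    have "\<bar>2 * pi * ?\<alpha>\<bar> = 2 * pi * \<bar>?\<alpha>\<bar>"
      by (subst abs_mult) simp
    also have "\<dots> \<le> 2 * pi * (1 / 6)"
      using q(2)[OF i(1)] by (intro mult_left_mono) auto
    finally have "\<bar>2 * pi * ?\<alpha>\<bar> \<le> pi / 3" by simp
    then have "cos (2 * pi * ?\<alpha>) \<ge> cos (pi / 3)"
      by (subst (1) cos_abs_real[symmetric]) (intro cos_monotone_0_pi_le, auto)
    then have "cos (N * Arg (z x)) \<ge> 1 / 2" using arg by (simp add: cos_60)
    moreover have "z x ^ N = of_real (cmod (z x) ^ N) * cis (N * Arg (z x))"
      by (metis DeMoivre2 rcis_cmod_Arg rcis_def)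
    ultimately show ?thesis
      using mult_left_mono[of "1/2" "cos (N * Arg (z x))" "cmod (z x) ^ N"] by simp
  qed
  have "cmod (z a) ^ m \<le> cmod (z a) ^ N"
    using S(3) q(1) by (intro power_increasing) (auto simp: N_def)
  then have "B < cmod (z a) ^ N / 2" using m by linarith
  also have "\<dots> \<le> Re (z a ^ N)" by (rule Re[OF S(2)])
  \<comment> \<open>All real parts are nonnegative, so the single term at \<open>a\<close> bounds
    the sum from below.\<close>
  also have "\<dots> \<le> (\<Sum>x\<in>S. Re (z x ^ N))"
    using S by (intro member_le_sum) (auto intro: order_trans[OF _ Re])
  also have "\<dots> \<le> cmod (\<Sum>x\<in>S. z x ^ N)"
    by (metis Re_sum complex_Re_le_cmod)
  finally show ?thesis by blast
qed

text \<open>Every power sum over \<open>S\<close> is bounded by \<open>card S\<close> on the unit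
  ball, whatever the exponent; so an exponent that is good for \<open>g\<close> alone
  suffices.\<close>

lemma separates_power_sum:
  fixes g :: "tshape \<Rightarrow>\<^sub>C complex"
  assumes S: "finite S" "a \<in> S" "cmod (g a) > 1"
    and perm: "\<And>\<phi> \<psi>. homeomorphism UNIV UNIV \<phi> \<psi> \<Longrightarrow> bij_betw \<phi> S S"
  shows "\<exists>P. continuous_polynomial P \<and> invariant_under composition_group P \<and>
    separates P g (cball 0 1)"
proof -
  obtain N where N: "cmod (\<Sum>x\<in>S. g x ^ N) > card S"
    using exists_large_power_sum[OF S(1,2), of g] S(3) by blast
  let ?P = "\<lambda>f. \<Sum>x\<in>S. apply_bcontfun f x ^ N"
  have "?P (\<gamma> f) = ?P f" if \<gamma>: "\<gamma> \<in> composition_group" for \<gamma> f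
  proof -
    obtain \<phi> \<psi> where hom: "homeomorphism UNIV UNIV \<phi> \<psi>"
        "\<And>f. apply_bcontfun (\<gamma> f) = apply_bcontfun f \<circ> \<phi>"
      using \<gamma> unfolding composition_group_def by blast
    show ?thesis
      using sum.reindex_bij_betw[OF perm[OF hom(1)], of "\<lambda>x. f x ^ N"] by (simp add: hom(2))
  qed
  then have "invariant_under composition_group ?P"
    by (auto simp: invariant_under_def)
  moreover have "cmod (?P f) \<le> card S" if "f \<in> cball 0 1" for f
  proof -
    have "cmod (f x) \<le> 1" for x
      using that norm_bounded[of f x] by (simp add: dist_norm)
    then have "cmod (f x ^ N) \<le> 1" for x
      by (simp add: norm_power power_le_one)
    then show ?thesis using sum_norm_le[of S "\<lambda>x. f x ^ N" "\<lambda>_. 1"] by simp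
  qed
  then have "(SUP f\<in>cball 0 1. ereal (cmod (?P f))) \<le> ereal (card S)"
    by (intro SUP_least) simp
  then have "separates ?P g (cball 0 1)"
    unfolding separates_def by (rule order_le_less_trans) (simp add: N)
  ultimately show ?thesis using continuous_polynomial_power_sum by blast
qed

theorem theorem4p11:
  fixes g :: "tshape \<Rightarrow>\<^sub>C complex"
  assumes "g \<notin> cball 0 1"
  shows "(\<exists>P. continuous_polynomial P \<and> invariant_under composition_group P \<and>
              separates P g (cball 0 1)) \<longleftrightarrow>
         Max {cmod (g (Abs_tshape 0)), cmod (g (Abs_tshape 1)),
              cmod (g (Abs_tshape (-1))), cmod (g (Abs_tshape \<i>))} > 1"
proof
  assume "\<exists>P. continuous_polynomial P \<and> invariant_under composition_group P \<and>
    separates P g (cball 0 1)"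
  then obtain P where P: "continuous_polynomial P" "invariant_under composition_group P"
      "separates P g (cball 0 1)" by blast
  show "Max {cmod (g (Abs_tshape 0)), cmod (g (Abs_tshape 1)),
              cmod (g (Abs_tshape (-1))), cmod (g (Abs_tshape \<i>))} > 1"
  proof (rule ccontr)
    assume "\<not> ?thesis"
    then have "cmod (g (Abs_tshape 0)) \<le> 1" "\<And>v. v \<in> tips \<Longrightarrow> cmod (g (Abs_tshape v)) \<le> 1"
      by (auto simp: tips_def not_less)
    then obtain f where f: "P f = P g" "f \<in> cball 0 1"
      using invariant_bounded_representative[OF P(1,2)] by blast
    \<comment> \<open>The value \<open>P g\<close> is already attained in the ball, at
      \<open>f\<close>.\<close>
    then have "ereal (cmod (P g)) \<le> (SUP f\<in>cball 0 1. ereal (cmod (P f)))"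
      by (intro SUP_upper2[of f]) auto
    then show False using P(3) by (simp add: separates_def)
  qed
next
  assume "Max {cmod (g (Abs_tshape 0)), cmod (g (Abs_tshape 1)),
              cmod (g (Abs_tshape (-1))), cmod (g (Abs_tshape \<i>))} > 1"
  \<comment> \<open>The two permuted sets: the branch point alone, and the three tips.\<close>
  then consider "cmod (g (Abs_tshape 0)) > 1" | "\<exists>v\<in>tips. cmod (g (Abs_tshape v)) > 1"
    by (subst (asm) Max_gr_iff) (auto simp: tips_def)
  then show "\<exists>P. continuous_polynomial P \<and> invariant_under composition_group P \<and>
    separates P g (cball 0 1)"
  proof cases
    case 1
    then show ?thesis
      by (intro separates_power_sum[of "{Abs_tshape 0}"])
        (auto simp: bij_betw_def dest: homeomorphism_fixes_0)
  next
    case 2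
    then obtain v where "v \<in> tips" "cmod (g (Abs_tshape v)) > 1" by blast
    moreover have "finite tips" by (simp add: tips_def)
    ultimately show ?thesis
      using separates_power_sum[of "Abs_tshape ` tips" "Abs_tshape v" g] bij_betw_tips by blast
  qed
qed

end
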